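(* Let $U$ be a super vertex operator algebra of CFT-type. Let $V\subseteq U$ be the subalgebra generated by $4$ primary vectors of weight $\frac32$ in $U$, so that $$V=\mathbb{C}\mathbf{1}\oplus V_{\frac12}\oplus V_1\oplus V_{\frac32}\oplus\cdots$$ is a conformally graded subspace of $U$. Assume that the following hold: (I) the subspace of $V_{\frac32}$ spanned by the four generators decomposes as $A\oplus B$, a pair of $2$-dimensional vector representations for $\mathfrak{sl}_2$, where (II) $A(1)B\cong\mathfrak{sl}_2$ (this is the $\mathfrak{sl}_2$ referred to in (I) and (IV)); (III) $A(0)A=B(0)B=0$; (IV) $T\mathfrak{sl}_2\cap A(0)B\neq 0$. Then $V\cong\mathcal{A}_{N=4}$ with central charge $c=6k$, where $k\in\mathbb{C}$ is the level of the $\widehat{\mathfrak{sl}}_2$ Kac-Moody subalgebra generated by $A(1)B$.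
   Context: **SVOA.** A super vertex operator algebra (SVOA) is a $\frac12\mathbb{Z}$-graded complex vector space $U=\bigoplus_{k\in\frac12\mathbb{Z}}U_k$ with parity $p(u)=2k \bmod 2$ for $u\in U_k$; vertex operators $Y(u,z)=\sum_{n\in\mathbb{Z}}u(n)z^{-n-1}$ with modes $u(n)\in\mathrm{End}(U)$; a vacuum $\mathbf{1}\in U_0$ with $Y(\mathbf 1,z)=\mathrm{Id}$, $u(-1)\mathbf 1=u$, $u(n)\mathbf 1=0$ for $n\ge0$; and a Virasoro element $\omega^U\in U_2$, $Y(\omega^U,z)=\sum_n L^U(n)z^{-n-2}$, whose modes satisfy the Virasoro relations for some central charge, with $L^U(0)u=ku$ for $u\in U_k$. For all $u,v$ one has $u(n)v=0$ for $n$ large, and for all $r,s,t\in\mathbb{Z}$ and (homogeneous) $u,v,w$, $$\sum_{i\ge0}\binom ri (u(t+i)v)(r+s-i)w=\sum_{i\ge0}(-1)^i\binom ti\{u(r+t-i)v(s+i)-(-1)^{t+p(u)p(v)}v(s+t-i)u(r+i)\}w.$$ The translation operator is $Tu=u(-2)\mathbf 1=L^U(-1)u$. $U$ is of CFT-type if $U_k=0$ for $k<0$ and $U_0=\mathbb{C}\mathbf 1$. A primary vector is a homogeneous $v$ with $L^U(n)v=0$ for all $n>0$. The subalgebra generated by a set of states is the span of all iterated mode products of these states applied to $\mathbf 1$. **Notation.** For subsets $X,Y\subseteq U$ and $n\in\mathbb{Z}$, $X(n)Y$ is the linear span of all $u(n)v$, $u\in X$, $v\in Y$. $A(1)B\subseteq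 V_1$ is a Lie algebra under $[u,v]=u(0)v$; it acts on states by $u\mapsto u(0)$. "Vector representation" means the $2$-dimensional irreducible $\mathfrak{sl}_2$-module. $T\mathfrak{sl}_2=\{Tu: u\in A(1)B\}$. The level $k$ is defined by $u(1)v=k(u,v)\mathbf 1$ for $u,v\in\mathfrak{sl}_2$, where $(\,,\,)$ is the invariant form with $(h,h)=2$ for the standard Cartan element $h$. **The $N=4$ algebra.** $V\cong\mathcal{A}_{N=4}$ with central charge $c$ means that $V$ is generated by four states $G^\pm,\overline G^\pm$ of weight $\frac32$ for which there are weight-one states $J^\pm,J^0$ and a Virasoro element $\omega$ of central charge $c$ satisfying (a) $J^0(0)J^\pm=\pm2J^\pm$; (b) $J^0(1)J^0=\frac c3\mathbf 1$; (c) $J^+(0)J^-=J^0$; (d) $J^+(1)J^-=\frac c6\mathbf 1$; (e) $J^0(0)G^\pm=\pm G^\pm$; (f) $J^0(0)\overline G^\pm=\pm\overline G^\pm$; (g) $J^\pm(0)G^\mp=G^\pm$; (h) $J^\pm(0)\overline G^\mp=-\overline G^\pm$; (i) $G^\pm(1)\overline G^\pm=2J^\pm$; (j) $G^\pm(1)\overline G^\mp=\pm J^0$; (k) $G^\pm(2)\overline G^\mp=\frac c3\mathbf 1$; (l) $G^\pm(0)\overline G^\pm=TJ^\pm$; (m) $G^\pm(0)\overline G^\mp=\omega\pm\frac12TJ^0$; together with the usual Virasoro relations ($J^\pm,J^0$ are primary of weight $1$ and $G^\pm,\overline G^\pm$ primary of weight $\frac32$ with respect to $\omega$), and all products $u(n)v$,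 $n\ge0$, of the states $G^\pm,\overline G^\pm,J^\pm,J^0,\omega$ not determined by the relations (a)–(m) and these Virasoro relations (directly or via super skew-symmetry) are zero; in particular $G(n)G=\overline G(n)\overline G=0$ for all $n\ge 0$, $J^\pm(0)G^\pm=J^\pm(0)\overline G^\pm=0$, $J(n)G=J(n)\overline G=0$ for $n\ge1$, and $G^\pm(2)\overline G^\pm=0$. *)

theory Defs
  imports "HOL-Analysis.Analysis" "HOL-Library.Groups_Big_Fun"
begin

text \<open>
  Weights are doubled throughout: \<open>wt U d\<close> is the subspace \<open>U\<^sub>d\<^sub>/\<^sub>2\<close>, so the parity of its elements
  is \<open>d mod 2\<close>. \<open>mode U u n v\<close> is \<open>u(n)v\<close>. The underlying set of \<open>U\<close> is the whole type \<open>'v\<close>.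
\<close>

record 'v svoa_data =
  scal :: "complex \<Rightarrow> 'v \<Rightarrow> 'v"
  wt   :: "int \<Rightarrow> 'v set"
  mode :: "'v \<Rightarrow> int \<Rightarrow> 'v \<Rightarrow> 'v"
  vac  :: 'v
  conf :: 'v

definition translation :: "'v svoa_data \<Rightarrow> 'v \<Rightarrow> 'v" where
  "translation U u = mode U u (-2) (vac U)"

definition vir :: "'v svoa_data \<Rightarrow> 'v \<Rightarrow> int \<Rightarrow> 'v \<Rightarrow> 'v" where
  "vir U \<omega> n v = mode U \<omega> (n + 1) v"

definition virasoro_relations ::
    "'v::ab_group_add svoa_data \<Rightarrow> 'v set \<Rightarrow> 'v \<Rightarrow> complex \<Rightarrow> bool" where
  "virasoro_relations U W \<omega> c \<longleftrightarrow>
     (\<forall>m n. \<forall>v\<in>W. vir U \<omega> m (vir U \<omega> n v) - vir U \<omega> n (vir U \<omega> m v)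
        = scal U (of_int (m - n)) (vir U \<omega> (m + n) v)
          + (if m + n = 0 then scal U (of_int (m ^ 3 - m) / 12 * c) v else 0))"

text \<open>
  \<open>\<omega>\<close> is a Virasoro element of the (sub)algebra with underlying set \<open>W\<close>. The grading on \<open>W\<close> is the
  one inherited from \<open>U\<close>; the whole of \<open>U\<close> is the case \<open>W = UNIV\<close>.
\<close>

definition virasoro_element ::
    "'v::ab_group_add svoa_data \<Rightarrow> 'v set \<Rightarrow> 'v \<Rightarrow> complex \<Rightarrow> bool" where
  "virasoro_element U W \<omega> c \<longleftrightarrow>
     \<omega> \<in> W \<inter> wt U 4 \<and>
     virasoro_relations U W \<omega> c \<and>
     (\<forall>d. \<forall>v \<in> W \<inter> wt U d. vir U \<omega> 0 v = scal U (of_int d / 2) v) \<and>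
     (\<forall>v\<in>W. vir U \<omega> (-1) v = translation U v)"

text \<open>
  The sums over \<open>i \<ge> 0\<close> in \<open>borcherds\<close> have finite support by \<open>truncation\<close> and linearity, so
  \<open>Sum_any\<close> is the honest sum.
\<close>

locale svoa = vector_space "scal U" for U :: "'v::ab_group_add svoa_data" +
  assumes wt_subspace: "subspace (wt U d)"
    and wt_direct_sum:
      "\<exists>!f. (\<forall>d. f d \<in> wt U d) \<and> finite {d. f d \<noteq> 0} \<and> Sum_any f = v"
    and mode_linear_left: "Vector_Spaces.linear (scal U) (scal U) (\<lambda>u. mode U u n v)"
    and mode_linear_right: "Vector_Spaces.linear (scal U) (scal U) (\<lambda>v. mode U u n v)"
    and truncation: "\<exists>N. \<forall>n\<ge>N. mode U u n v = 0"
    and vac_weight: "vac U \<in> wt U 0"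
    and vac_mode: "mode U (vac U) n v = (if n = -1 then v else 0)"
    and creation: "mode U u (-1) (vac U) = u"
    and creation_nonneg: "n \<ge> 0 \<Longrightarrow> mode U u n (vac U) = 0"
    and conformal: "\<exists>c. virasoro_element U UNIV (conf U) c"
    and borcherds:
      "\<lbrakk>u \<in> wt U d; v \<in> wt U e; w \<in> wt U f\<rbrakk> \<Longrightarrow>
        Sum_any (\<lambda>i::nat. scal U (of_int r gchoose i)
            (mode U (mode U u (t + int i) v) (r + s - int i) w))
      = Sum_any (\<lambda>i::nat. scal U ((-1) ^ i * (of_int t gchoose i))
            (mode U u (r + t - int i) (mode U v (s + int i) w)
             - scal U ((-1) powi (t + (d mod 2) * (e mod 2)))
                 (mode U v (s + t - int i) (mode U u (r + int i) w))))"

abbreviation cspan :: "'v::ab_group_add svoa_data \<Rightarrow> 'v set \<Rightarrow> 'v set" where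
  "cspan U \<equiv> module.span (scal U)"

abbreviation csubspace :: "'v::ab_group_add svoa_data \<Rightarrow> 'v set \<Rightarrow> bool" where
  "csubspace U \<equiv> module.subspace (scal U)"

abbreviation cdim :: "'v::ab_group_add svoa_data \<Rightarrow> 'v set \<Rightarrow> nat" where
  "cdim U \<equiv> vector_space.dim (scal U)"

definition cft_type :: "'v::ab_group_add svoa_data \<Rightarrow> bool" where
  "cft_type U \<longleftrightarrow> (\<forall>d<0. wt U d = {0}) \<and> wt U 0 = cspan U {vac U}"

definition primary ::
    "'v::ab_group_add svoa_data \<Rightarrow> 'v \<Rightarrow> int \<Rightarrow> 'v \<Rightarrow> bool" where
  "primary U \<omega> d v \<longleftrightarrow> v \<in> wt U d \<and> (\<forall>n>0. vir U \<omega> n v = 0)"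

inductive_set mode_words :: "'v svoa_data \<Rightarrow> 'v set \<Rightarrow> 'v set" for U S where
  vac_word: "vac U \<in> mode_words U S"
| mode_word: "u \<in> S \<Longrightarrow> w \<in> mode_words U S \<Longrightarrow> mode U u n w \<in> mode_words U S"

definition generated :: "'v::ab_group_add svoa_data \<Rightarrow> 'v set \<Rightarrow> 'v set" where
  "generated U S = cspan U (mode_words U S)"

text \<open>The span \<open>X(n)Y\<close>.\<close>

definition mode_span ::
    "'v::ab_group_add svoa_data \<Rightarrow> 'v set \<Rightarrow> int \<Rightarrow> 'v set \<Rightarrow> 'v set" where
  "mode_span U X n Y = cspan U {mode U u n v | u v. u \<in> X \<and> v \<in> Y}"

definition sl2 :: "(complex^2^2) set" where
  "sl2 = {M. trace M = 0}"

definition sl2_cartan :: "complex^2^2" where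
  "sl2_cartan = vector [vector [1, 0], vector [0, -1]]"

text \<open>
  \<open>\<phi>\<close> is an isomorphism of Lie algebras from \<open>sl2\<close> onto \<open>g\<close> with bracket \<open>[u,v] = u(0)v\<close>.
  The scalar multiple of a matrix \<open>M\<close> by \<open>a\<close> is \<open>mat a ** M\<close>.
\<close>

definition sl2_iso ::
    "'v::ab_group_add svoa_data \<Rightarrow> 'v set \<Rightarrow> (complex^2^2 \<Rightarrow> 'v) \<Rightarrow> bool" where
  "sl2_iso U g \<phi> \<longleftrightarrow>
     bij_betw \<phi> sl2 g \<and>
     (\<forall>M\<in>sl2. \<forall>N\<in>sl2. \<phi> (M + N) = \<phi> M + \<phi> N) \<and>
     (\<forall>a. \<forall>M\<in>sl2. \<phi> (mat a ** M) = scal U a (\<phi> M)) \<and>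
     (\<forall>M\<in>sl2. \<forall>N\<in>sl2. \<phi> (M ** N - N ** M) = mode U (\<phi> M) 0 (\<phi> N))"

definition invariant_subspace ::
    "'v::ab_group_add svoa_data \<Rightarrow> 'v set \<Rightarrow> 'v set \<Rightarrow> bool" where
  "invariant_subspace U g W \<longleftrightarrow>
     csubspace U W \<and> (\<forall>x\<in>g. \<forall>w\<in>W. mode U x 0 w \<in> W)"

definition irreducible_module ::
    "'v::ab_group_add svoa_data \<Rightarrow> 'v set \<Rightarrow> 'v set \<Rightarrow> bool" where
  "irreducible_module U g W \<longleftrightarrow>
     invariant_subspace U g W \<and> W \<noteq> {0} \<and>
     (\<forall>W'. W' \<subseteq> W \<and> invariant_subspace U g W' \<longrightarrow> W' = {0} \<or> W' = W)"

definition vector_representation ::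
    "'v::ab_group_add svoa_data \<Rightarrow> 'v set \<Rightarrow> 'v set \<Rightarrow> bool" where
  "vector_representation U g W \<longleftrightarrow> irreducible_module U g W \<and> cdim U W = 2"

definition invariant_form ::
    "'v::ab_group_add svoa_data \<Rightarrow> 'v set \<Rightarrow> ('v \<Rightarrow> 'v \<Rightarrow> complex) \<Rightarrow> bool" where
  "invariant_form U g \<beta> \<longleftrightarrow>
     (\<forall>x\<in>g. \<forall>y\<in>g. \<forall>z\<in>g. \<beta> (x + y) z = \<beta> x z + \<beta> y z) \<and>
     (\<forall>a. \<forall>x\<in>g. \<forall>y\<in>g. \<beta> (scal U a x) y = a * \<beta> x y) \<and>
     (\<forall>x\<in>g. \<forall>y\<in>g. \<beta> x y = \<beta> y x) \<and>
     (\<forall>x\<in>g. \<forall>y\<in>g. \<forall>z\<in>g. \<beta> (mode U x 0 y) z = \<beta> x (mode U y 0 z))"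

definition level ::
    "'v::ab_group_add svoa_data \<Rightarrow> 'v set \<Rightarrow> (complex^2^2 \<Rightarrow> 'v) \<Rightarrow> complex \<Rightarrow> bool" where
  "level U g \<phi> k \<longleftrightarrow>
     (\<exists>\<beta>. invariant_form U g \<beta> \<and> \<beta> (\<phi> sl2_cartan) (\<phi> sl2_cartan) = 2 \<and>
        (\<forall>u\<in>g. \<forall>v\<in>g. mode U u 1 v = scal U (k * \<beta> u v) (vac U)))"

text \<open>
  The superscripts \<open>\<plusminus>\<close> are indices \<open>s \<in> {1, -1}\<close>: \<open>G 1\<close> is \<open>G\<^sup>+\<close>, \<open>G (-1)\<close> is \<open>G\<^sup>-\<close>, and \<open>Gb s\<close>
  stands for the barred generators; values at other indices are irrelevant. The products
  with \<open>\<omega>\<close> are fixed by \<open>virasoro_element\<close> (which gives \<open>\<omega>(0)v = Tv\<close>, \<open>\<omega>(1)v\<close> and \<open>\<omega>(n)\<omega>\<close>) and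
  \<open>primary\<close>. Every other pair of states is listed in one order; the opposite order follows by
  super skew-symmetry.
\<close>

definition N4_algebra :: "'v::ab_group_add svoa_data \<Rightarrow> 'v set \<Rightarrow> complex \<Rightarrow> bool" where
  "N4_algebra U V c \<longleftrightarrow> (\<exists>(G :: int \<Rightarrow> 'v) (Gb :: int \<Rightarrow> 'v) (J :: int \<Rightarrow> 'v) J0 \<omega>.
     distinct [G 1, G (-1), Gb 1, Gb (-1)] \<and>
     V = generated U {G 1, G (-1), Gb 1, Gb (-1)} \<and>
     virasoro_element U V \<omega> c \<and>
     J0 \<in> V \<and> primary U \<omega> 2 J0 \<and>
     mode U J0 1 J0 = scal U (c / 3) (vac U) \<and>
     mode U (J 1) 0 (J (-1)) = J0 \<and>
     mode U (J 1) 1 (J (-1)) = scal U (c / 6) (vac U) \<and>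
     (\<forall>s\<in>{1, -1}.
        J s \<in> V \<and> primary U \<omega> 2 (J s) \<and> primary U \<omega> 3 (G s) \<and> primary U \<omega> 3 (Gb s) \<and>
        mode U J0 0 (J s) = scal U (2 * of_int s) (J s) \<and>
        mode U J0 0 (G s) = scal U (of_int s) (G s) \<and>
        mode U J0 0 (Gb s) = scal U (of_int s) (Gb s) \<and>
        mode U (J s) 0 (G (-s)) = G s \<and>
        mode U (J s) 0 (Gb (-s)) = - Gb s \<and>
        mode U (G s) 1 (Gb s) = scal U 2 (J s) \<and>
        mode U (G s) 1 (Gb (-s)) = scal U (of_int s) J0 \<and>
        mode U (G s) 2 (Gb (-s)) = scal U (c / 3) (vac U) \<and>
        mode U (G s) 0 (Gb s) = translation U (J s) \<and>
        mode U (G s) 0 (Gb (-s)) = \<omega> + scal U (of_int s / 2) (translation U J0)) \<and>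
     (\<forall>n\<ge>0. n \<noteq> 1 \<longrightarrow> mode U J0 n J0 = 0) \<and>
     (\<forall>n\<ge>2. mode U (J 1) n (J (-1)) = 0) \<and>
     (\<forall>s\<in>{1, -1}.
        (\<forall>n\<ge>1. mode U J0 n (J s) = 0) \<and>
        (\<forall>n\<ge>0. mode U (J s) n (J s) = 0) \<and>
        (\<forall>n\<ge>1. mode U J0 n (G s) = 0) \<and>
        (\<forall>n\<ge>1. mode U J0 n (Gb s) = 0) \<and>
        (\<forall>n\<ge>1. mode U (J s) n (G (-s)) = 0) \<and>
        (\<forall>n\<ge>1. mode U (J s) n (Gb (-s)) = 0) \<and>
        (\<forall>n\<ge>0. mode U (J s) n (G s) = 0) \<and>
        (\<forall>n\<ge>0. mode U (J s) n (Gb s) = 0) \<and>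
        (\<forall>n\<ge>0. mode U (G s) n (G s) = 0) \<and>
        (\<forall>n\<ge>0. mode U (G s) n (G (-s)) = 0) \<and>
        (\<forall>n\<ge>0. mode U (Gb s) n (Gb s) = 0) \<and>
        (\<forall>n\<ge>0. mode U (Gb s) n (Gb (-s)) = 0) \<and>
        (\<forall>n\<ge>2. mode U (G s) n (Gb s) = 0) \<and>
        (\<forall>n\<ge>3. mode U (G s) n (Gb (-s)) = 0)))"

end

theory Submission
  imports Defs
begin

text \<open>
  Choose weight bases \<open>a\<^sup>\<plusminus>\<close> of \<open>A\<close> and \<open>b\<^sup>\<plusminus>\<close> of \<open>B\<close>. Equivariance of \<open>A \<otimes> B \<rightarrow> A(1)B\<close> fixes all
  first products up to one scalar, which is absorbed by rescaling \<open>B\<close>; this gives \<open>G\<^sup>\<plusminus>\<close> and the barred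
  generators. Skew-symmetry turns \<open>A(0)A = 0\<close> into \<open>T(A(1)A) = 0\<close>, and \<open>T\<close> is injective on weight one,
  so all singular products inside \<open>A\<close> vanish, and likewise inside \<open>B\<close>. Hypothesis (IV) forces
  \<open>G\<^sup>+(0)Gb\<^sup>+\<close> to be proportional to \<open>TJ\<^sup>+\<close>; applying \<open>L(1)\<close> shows that the factor is one, and lowering with
  \<open>J\<^sup>-(0)\<close> shows that \<open>\<omega> = G\<^sup>s(0)Gb\<^sup>-\<^sup>s - (s/2) TJ\<^sup>0\<close> does not depend on the sign \<open>s\<close>. The singular
  products of \<open>\<omega>\<close> with the generators then agree with those of the conformal vector of \<open>U\<close>. Hence
  the modes of the difference of the two vectors commute with those of the generators, and \<open>\<omega>\<close> and the
  conformal vector of \<open>U\<close> have the same nonnegative modes on \<open>V\<close>.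
\<close>

section \<open>Consequences of the Borcherds identity\<close>

context svoa
begin

abbreviation scl (infixr "\<cdot>" 75) where "scl \<equiv> scal U"
abbreviation md where "md \<equiv> mode U"

text \<open>Virasoro modes are written as \<open>md (conf U) n = L(n - 1)\<close> below.\<close>

lemma mode_left: "md (x + y) n v = md x n v + md y n v" "md (a \<cdot> x) n v = a \<cdot> md x n v"
  "md 0 n v = 0" "md (- x) n v = - md x n v" "md (x - y) n v = md x n v - md y n v"
proof -
  interpret l: Vector_Spaces.linear "scal U" "scal U" "\<lambda>u. mode U u n v" by (rule mode_linear_left)
  show "md (x + y) n v = md x n v + md y n v" "md (a \<cdot> x) n v = a \<cdot> md x n v"
  "md 0 n v = 0" "md (- x) n v = - md x n v" "md (x - y) n v = md x n v - md y n v"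
    by (simp_all add: l.add l.scale l.zero l.neg l.diff)
qed

lemma mode_right: "md u n (x + y) = md u n x + md u n y" "md u n (a \<cdot> x) = a \<cdot> md u n x"
  "md u n 0 = 0" "md u n (- x) = - md u n x" "md u n (x - y) = md u n x - md u n y"
  "md u n (sum f I) = (\<Sum>i\<in>I. md u n (f i))"
proof -
  interpret l: Vector_Spaces.linear "scal U" "scal U" "\<lambda>v. mode U u n v" by (rule mode_linear_right)
  show "md u n (x + y) = md u n x + md u n y" "md u n (a \<cdot> x) = a \<cdot> md u n x"
  "md u n 0 = 0" "md u n (- x) = - md u n x" "md u n (x - y) = md u n x - md u n y"
  "md u n (sum f I) = (\<Sum>i\<in>I. md u n (f i))"
    by (simp_all add: l.add l.scale l.zero l.neg l.diff l.sum)
qed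

lemmas mode_lin = mode_left mode_right

text \<open>The Borcherds identity is assumed for homogeneous \<open>w\<close> only. Its
  consequences are linear in \<open>w\<close>, and every vector is a finite sum of homogeneous ones,
  so this lemma extends them to all \<open>w\<close>.\<close>

lemma linear_eqI_homogeneous:
  assumes F: "Vector_Spaces.linear (scal U) (scal U) F" and H: "Vector_Spaces.linear (scal U) (scal U) H"
    and "\<And>d w. w \<in> wt U d \<Longrightarrow> F w = H w"
  shows "F v = H v"
proof -
  interpret F: Vector_Spaces.linear "scal U" "scal U" F by (rule F)
  interpret H: Vector_Spaces.linear "scal U" "scal U" H by (rule H)
  obtain f where f: "\<And>d. f d \<in> wt U d" "finite {d. f d \<noteq> 0}" "Sum_any f = v"
    using wt_direct_sum[of v] by blast
  have v: "v = sum f {d. f d \<noteq> 0}" using f(3) by (simp add: Sum_any.expand_set)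
  show ?thesis unfolding v F.sum H.sum by (intro sum.cong) (use assms(3) f(1) in auto)
qed

lemma Sum_any_lessThan:
  fixes g :: "nat \<Rightarrow> 'v"
  assumes "\<And>i. i \<ge> N \<Longrightarrow> g i = 0"
  shows "Sum_any g = (\<Sum>i<N. g i)"
proof (rule Sum_any.expand_superset)
  show "{i. g i \<noteq> 0} \<subseteq> {..<N}" using assms by (auto simp flip: not_le)
qed simp

text \<open>The Koszul sign of two states of doubled weights \<open>d\<close> and \<open>e\<close>:
  it is \<open>-1\<close> exactly when both are odd.\<close>

definition sgn_wt :: "int \<Rightarrow> int \<Rightarrow> complex" where
  "sgn_wt d e = (-1) powi ((d mod 2) * (e mod 2))"

lemma sgn_wt_simps: "even d \<Longrightarrow> sgn_wt d e = 1" "even e \<Longrightarrow> sgn_wt d e = 1"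
  "odd d \<Longrightarrow> odd e \<Longrightarrow> sgn_wt d e = -1"
  by (auto simp: sgn_wt_def odd_iff_mod_2_eq_one)

text \<open>This is the Borcherds identity at \<open>t = 0\<close>: on the right all binomials with
  \<open>i > 0\<close> vanish, which leaves the supercommutator.\<close>

lemma commutator:
  assumes "u \<in> wt U d" "v \<in> wt U e" "\<And>i. i \<ge> N \<Longrightarrow> md u (int i) v = 0"
  shows "md u r (md v s w) - sgn_wt d e \<cdot> md v s (md u r w)
    = (\<Sum>i<N. (of_int r gchoose i) \<cdot> md (md u (int i) v) (r + s - int i) w)"
proof (rule linear_eqI_homogeneous[where v = w])
  show "Vector_Spaces.linear (scal U) (scal U) (\<lambda>w. md u r (md v s w) - sgn_wt d e \<cdot> md v s (md u r w))"
    by (rule Vector_Spaces.linear_iff[THEN iffD2]) (simp add: vector_space_axioms mode_lin algebra_simps scale_right_distrib mult.commute)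
  show "Vector_Spaces.linear (scal U) (scal U) (\<lambda>w. \<Sum>i<N. (of_int r gchoose i) \<cdot> md (md u (int i) v) (r + s - int i) w)"
    by (rule Vector_Spaces.linear_iff[THEN iffD2])
       (simp add: vector_space_axioms mode_lin scale_right_distrib sum.distrib scale_sum_right mult.commute)
  fix f w assume w: "w \<in> wt U f"
  have L: "Sum_any (\<lambda>i::nat. (of_int r gchoose i) \<cdot> md (md u (0 + int i) v) (r + s - int i) w)
     = (\<Sum>i<N. (of_int r gchoose i) \<cdot> md (md u (int i) v) (r + s - int i) w)"
    by (subst Sum_any_lessThan[where N = N]) (auto simp: assms mode_lin)
  have R: "Sum_any (\<lambda>i::nat. scal U ((-1) ^ i * (of_int 0 gchoose i))
            (mode U u (r + 0 - int i) (mode U v (s + int i) w)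
             - scal U ((-1) powi (0 + (d mod 2) * (e mod 2)))
                 (mode U v (s + 0 - int i) (mode U u (r + int i) w))))
     = md u r (md v s w) - sgn_wt d e \<cdot> md v s (md u r w)"
    by (subst Sum_any_lessThan[where N = 1]) (auto simp: gbinomial_0 sgn_wt_def gbinomial_0_left)
  show "md u r (md v s w) - sgn_wt d e \<cdot> md v s (md u r w)
    = (\<Sum>i<N. (of_int r gchoose i) \<cdot> md (md u (int i) v) (r + s - int i) w)"
    using borcherds[OF assms(1,2) w, of r 0 s] L R by simp
qed

lemma truncation_nat: "\<exists>N. \<forall>i\<ge>N. md u (int i) v = 0"
  using truncation[of u v] by (metis int_nat_eq nat_le_iff order.trans of_nat_0_le_iff linear nat_0_le nat_mono)

text \<open>At \<open>r = 0\<close> only the term \<open>i = 0\<close> of the commutator formula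
  survives, so zero modes are superderivations of all products.\<close>

lemma zero_mode_bracket:
  assumes "u \<in> wt U d" "v \<in> wt U e"
  shows "md (md u 0 v) s w = md u 0 (md v s w) - sgn_wt d e \<cdot> md v s (md u 0 w)"
proof -
  obtain N where N: "\<forall>i\<ge>N. md u (int i) v = 0" using truncation_nat by blast
  have "md u 0 (md v s w) - sgn_wt d e \<cdot> md v s (md u 0 w) =
    (\<Sum>i<Suc N. (of_int 0 gchoose i) \<cdot> md (md u (int i) v) (0 + s - int i) w)"
    by (rule commutator) (use assms N in auto)
  also have "\<dots> = (\<Sum>i\<in>{0}. (of_int 0 gchoose i) \<cdot> md (md u (int i) v) (0 + s - int i) w)"
    by (intro sum.mono_neutral_right) (auto simp: gbinomial_0_left)
  finally show ?thesis by simp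
qed

text \<open>Borcherds identity with \<open>w\<close> the vacuum, \<open>r = -1\<close>, \<open>s = 0\<close> and \<open>t = n\<close>.\<close>
lemma skew_symmetry:
  assumes "u \<in> wt U d" "v \<in> wt U e" "\<And>i. i \<ge> 2 \<Longrightarrow> md u (n + int i) v \<in> cspan U {vac U}"
  shows "md v n u = - (((-1) powi n * sgn_wt d e) \<cdot> (md u n v - translation U (md u (n + 1) v)))"
proof -
  \<comment> \<open>A multiple of the vacuum has no mode other than the one at \<open>-1\<close>,
    while here the index is \<open>-1 - i\<close>. Only two terms of the sum remain.\<close>
  have z: "md (md u (n + int i) v) (- 1 - int i) (vac U) = 0" if i: "i \<ge> 2" for i
  proof -
    obtain a where "md u (n + int i) v = a \<cdot> vac U"
      using assms(3)[OF i] by (auto simp: span_singleton)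
    thus ?thesis using i by (simp add: mode_lin vac_mode)
  qed
  have L: "Sum_any (\<lambda>i::nat. scal U (of_int (-1) gchoose i)
            (mode U (mode U u (n + int i) v) (- 1 + 0 - int i) (vac U)))
     = md u n v - translation U (md u (n + 1) v)"
    by (subst Sum_any_lessThan[where N = 2])
       (auto simp: z eval_nat_numeral creation translation_def gbinomial_1)
  have R: "Sum_any (\<lambda>i::nat. scal U ((-1) ^ i * (of_int n gchoose i))
            (mode U u (- 1 + n - int i) (mode U v (0 + int i) (vac U))
             - scal U ((-1) powi (n + (d mod 2) * (e mod 2)))
                 (mode U v (0 + n - int i) (mode U u (- 1 + int i) (vac U)))))
     = - (((-1) powi n * sgn_wt d e) \<cdot> md v n u)"
    by (subst Sum_any_lessThan[where N = 1])
       (auto simp: creation creation_nonneg mode_lin sgn_wt_def power_int_add)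
  have "md u n v - translation U (md u (n + 1) v) = - (((-1) powi n * sgn_wt d e) \<cdot> md v n u)"
    using borcherds[OF assms(1,2) vac_weight, of "-1" n 0] L R by simp
  moreover have "((-1) powi n * sgn_wt d e) * ((-1) powi n * sgn_wt d e) = (1::complex)"
    by (cases "even n"; cases "even d"; cases "even e") (auto simp: sgn_wt_simps)
  ultimately show ?thesis by simp
qed

text \<open>Take the vacuum as second state with \<open>r = 0\<close>, \<open>t = -2\<close>,
  \<open>s = n\<close>. The signed binomial coefficient is \<open>i + 1\<close>, and the vacuum
  modes leave at most one term.\<close>

lemma mode_translation:
  assumes u: "u \<in> wt U d"
  shows "md (translation U u) n w = - (of_int n \<cdot> md u (n - 1) w)"
proof (rule linear_eqI_homogeneous[where v = w])
  show "Vector_Spaces.linear (scal U) (scal U) (md (translation U u) n)" by (rule mode_linear_right)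
  show "Vector_Spaces.linear (scal U) (scal U) (\<lambda>w. - (of_int n \<cdot> md u (n - 1) w))"
    by (rule Vector_Spaces.linear_iff[THEN iffD2]) (simp add: vector_space_axioms mode_lin algebra_simps scale_right_distrib mult.commute)
  fix f w assume w: "w \<in> wt U f"
  have g: "(- 1) ^ i * (- 2 gchoose i) = (of_nat (Suc i) :: complex)" for i
  proof -
    have "(-2 gchoose i) = (-1) ^ i * ((of_nat (Suc i) :: complex) gchoose i)"
      using gbinomial_minus[of "2::complex" i] by (simp add: add.commute)
    also have "of_nat (Suc i) gchoose i = (of_nat (Suc i) :: complex)"
      by (subst binomial_gbinomial[symmetric]) simp
    finally show ?thesis by simp
  qed
  let ?g = "\<lambda>i::nat. scal U ((-1) ^ i * (of_int (-2) gchoose i))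
            (mode U u (0 + - 2 - int i) (mode U (vac U) (n + int i) w)
             - scal U ((-1) powi (- 2 + (d mod 2) * (0 mod 2)))
                 (mode U (vac U) (n + -2 - int i) (mode U u (0 + int i) w)))"
  have "Sum_any ?g = - (of_int n \<cdot> md u (n - 1) w)"
  proof -
    \<comment> \<open>The first summand survives at \<open>i = -1 - n\<close>, for
      \<open>n < 0\<close>; the second at \<open>i = n - 1\<close>, for \<open>n \<ge> 1\<close>.
      For \<open>n = 0\<close> nothing survives and \<open>j\<close> takes the default value
      0.\<close>
    define j where "j = (if n < 0 then nat (-1-n) else nat (n - 1))"
    have "Sum_any ?g = sum ?g {j}"
      by (rule Sum_any.expand_superset) (auto simp: vac_mode mode_lin j_def)
    also have "\<dots> = - (of_int n \<cdot> md u (n - 1) w)"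
      by (auto simp: g vac_mode mode_lin j_def)
    finally show ?thesis .
  qed
  moreover have "Sum_any (\<lambda>i::nat. scal U (of_int 0 gchoose i)
            (mode U (mode U u (-2 + int i) (vac U)) (0 + n - int i) w)) = md (translation U u) n w"
    by (subst Sum_any_lessThan[where N = 1]) (auto simp: gbinomial_0_left translation_def)
  ultimately show "md (translation U u) n w = - (of_int n \<cdot> md u (n - 1) w)"
    using borcherds[OF u vac_weight w, of 0 "-2" n] by simp
qed

section \<open>Translation, Virasoro modes and the grading\<close>

lemma conf_weight: "conf U \<in> wt U 4"
  and translation_eq_conf: "translation U v = md (conf U) 0 v"
  and conf_wt: "v \<in> wt U d \<Longrightarrow> md (conf U) 1 v = (of_int d / 2) \<cdot> v"
  using conformal by (auto simp: virasoro_element_def vir_def)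

lemma translation_linear:
  "translation U (x + y) = translation U x + translation U y"
  "translation U (a \<cdot> x) = a \<cdot> translation U x" "translation U 0 = 0"
  "translation U (- x) = - translation U x" "translation U (x - y) = translation U x - translation U y"
  by (simp_all add: translation_def mode_lin)

lemma translation_vac: "translation U (vac U) = 0"
  by (simp add: translation_def vac_mode)

lemma translation_derivation:
  assumes "v \<in> wt U d"
  shows "translation U (md v n w) = md v n (translation U w) - of_int n \<cdot> md v (n - 1) w"
  using zero_mode_bracket[OF conf_weight assms, of n w] mode_translation[OF assms, of n w]
  by (simp add: sgn_wt_simps translation_eq_conf algebra_simps)

text \<open>Only \<open>conf(0)x = Tx\<close> and \<open>conf(1)x = (d/2)x\<close> contribute; by
  \<open>mode_translation\<close> the first yields the summand \<open>-(r + n)\<close>. With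
  \<open>conf(r) = L(r - 1)\<close> this is the usual bracket of a Virasoro mode with a primary
  field.\<close>

lemma conf_primary_commutator:
  assumes x: "x \<in> wt U d" and "\<And>i::nat. i \<ge> 2 \<Longrightarrow> md (conf U) (int i) x = 0"
  shows "md (conf U) r (md x n w)
    = md x n (md (conf U) r w) + (of_int r * (of_int d / 2) - of_int (r + n)) \<cdot> md x (r + n - 1) w"
proof -
  have "md (conf U) r (md x n w) - md x n (md (conf U) r w)
      = md (translation U x) (r + n) w + (of_int r * (of_int d / 2)) \<cdot> md x (r + n - 1) w"
    using commutator[OF conf_weight x, of 2 r n w] assms
    by (simp add: sgn_wt_simps eval_nat_numeral conf_wt translation_eq_conf mode_lin)
  thus ?thesis unfolding mode_translation[OF x] by (simp add: scale_left_diff_distrib diff_eq_eq)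
qed

lemma wt_lin: "0 \<in> wt U d" "x \<in> wt U d \<Longrightarrow> y \<in> wt U d \<Longrightarrow> x + y \<in> wt U d"
  "x \<in> wt U d \<Longrightarrow> a \<cdot> x \<in> wt U d" "x \<in> wt U d \<Longrightarrow> - x \<in> wt U d"
  "x \<in> wt U d \<Longrightarrow> y \<in> wt U d \<Longrightarrow> x - y \<in> wt U d"
  by (simp_all add: wt_subspace subspace_0 subspace_add subspace_scale subspace_neg subspace_diff)

text \<open>Scaling the component of weight \<open>e\<close> by \<open>(e - d)/2\<close> produces a
  decomposition of \<open>L(0)v - (d/2)v = 0\<close>. Uniqueness of decompositions kills every
  component with \<open>e \<noteq> d\<close>.\<close>

lemma wt_eigenvector:
  assumes "md (conf U) 1 v = (of_int d / 2) \<cdot> v"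
  shows "v \<in> wt U d"
proof -
  obtain f where f: "\<And>d. f d \<in> wt U d" "finite {d. f d \<noteq> 0}" "Sum_any f = v"
    using wt_direct_sum[of v] by blast
  define g where "g e = (of_int (e - d) / 2) \<cdot> f e" for e
  have g: "g e \<in> wt U e" for e by (simp add: g_def wt_lin f)
  have sub: "{e. g e \<noteq> 0} \<subseteq> {e. f e \<noteq> 0}" by (auto simp: g_def)
  hence fin: "finite {e. g e \<noteq> 0}" using f(2) finite_subset by blast
  have v: "v = sum f {d. f d \<noteq> 0}" using f(3) by (simp add: Sum_any.expand_set)
  have "Sum_any g = sum g {e. f e \<noteq> 0}" by (rule Sum_any.expand_superset) (use f(2) sub in auto)
  also have "\<dots> = (\<Sum>e | f e \<noteq> 0. md (conf U) 1 (f e) - (of_int d / 2) \<cdot> f e)"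
    by (intro sum.cong) (auto simp: g_def conf_wt[OF f(1)] diff_divide_distrib scale_left_diff_distrib)
  also have "\<dots> = md (conf U) 1 v - (of_int d / 2) \<cdot> v"
    unfolding v by (simp add: mode_lin sum_subtractf scale_sum_right)
  also have "\<dots> = 0" using assms by simp
  finally have "Sum_any g = 0" .
  hence "(\<forall>d. g d \<in> wt U d) \<and> finite {d. g d \<noteq> 0} \<and> Sum_any g = 0" using g fin by blast
  moreover have "(\<forall>d. 0 \<in> wt U d) \<and> finite {d::int. (0::'v) \<noteq> 0} \<and> Sum_any (\<lambda>_::int. 0::'v) = 0"
    by (simp add: wt_lin)
  ultimately have "g = (\<lambda>_. 0)"
    by (rule Uniq_D[OF ex1_iff_ex_Uniq[THEN iffD1, OF wt_direct_sum[of 0], THEN conjunct2]])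
  hence "f e = 0" if "e \<noteq> d" for e using that by (auto simp: g_def fun_eq_iff dest: spec[of _ e])
  hence "Sum_any f = sum f {d}" by (intro Sum_any.expand_superset) auto
  thus ?thesis using f(1)[of d] f(3) by simp
qed

text \<open>Compatibility of the modes with the grading follows from the bracket of
  \<open>L(0) = conf(1)\<close> with \<open>u(n)\<close>, whose terms stop at \<open>i = 1\<close>;
  eigenvectors of \<open>L(0)\<close> are then homogeneous.\<close>

lemma mode_wt:
  assumes u: "u \<in> wt U d" and v: "v \<in> wt U e" and "f = d + e - 2 * n - 2"
  shows "md u n v \<in> wt U f"
proof (rule wt_eigenvector)
  obtain N where N: "\<forall>i\<ge>N. md (conf U) (int i) u = 0" using truncation_nat by blast
  have z: "((1::complex) gchoose i) = 0" if "i \<ge> 2" for i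
    using binomial_gbinomial[of 1 i, where 'a = complex] that by (simp add: binomial_eq_0)
  have "md (conf U) 1 (md u n v) - md u n (md (conf U) 1 v)
      = (\<Sum>i<N + 2. (of_int 1 gchoose i) \<cdot> md (md (conf U) (int i) u) (1 + n - int i) v)"
    using commutator[OF conf_weight u, of "N + 2" 1 n v] N by (simp add: sgn_wt_simps)
  also have "\<dots> = (\<Sum>i<2. (of_int 1 gchoose i) \<cdot> md (md (conf U) (int i) u) (1 + n - int i) v)"
    by (intro sum.mono_neutral_right) (auto simp: z)
  also have "\<dots> = (of_int d / 2 - of_int (1 + n)) \<cdot> md u n v"
    using mode_translation[OF u, of "1 + n" v]
    by (simp add: eval_nat_numeral conf_wt[OF u] translation_eq_conf mode_lin algebra_simps)
  finally have "md (conf U) 1 (md u n v) = (of_int e / 2 + (of_int d / 2 - of_int (1 + n))) \<cdot> md u n v"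
    by (simp add: conf_wt[OF v] mode_lin algebra_simps)
  also have "of_int e / 2 + (of_int d / 2 - of_int (1 + n)) = (of_int f / 2 :: complex)"
    unfolding assms(3) by (simp add: field_simps)
  finally show "md (conf U) 1 (md u n v) = (of_int f / 2) \<cdot> md u n v" .
qed

lemma translation_wt: "v \<in> wt U d \<Longrightarrow> translation U v \<in> wt U (d + 2)"
  unfolding translation_eq_conf by (rule mode_wt[OF conf_weight]) auto

lemma double_scale: "2 \<cdot> x = x + x"
  using scale_left_distrib[of 1 1 x] by simp

lemma double_eq_0: "x + x = 0 \<longleftrightarrow> x = (0::'v)"
  using double_scale[of x] by (metis scale_eq_0_iff zero_neq_numeral)

lemma zero_mode_derivation:
  assumes "x \<in> wt U d" "even d" "u \<in> wt U e"
  shows "md x 0 (md u n v) = md (md x 0 u) n v + md u n (md x 0 v)"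
  using zero_mode_bracket[OF assms(1,3), of n v] assms(2) by (simp add: sgn_wt_simps)

lemma zero_mode_translation: "x \<in> wt U d \<Longrightarrow> md x 0 (translation U y) = translation U (md x 0 y)"
  using translation_derivation[of x d 0 y] by simp

lemma neg_eq_self: "- x = x \<longleftrightarrow> x = (0::'v)"
  using double_eq_0[of x] by (metis add.right_inverse neg_0_equal_iff_equal)

section \<open>Linear algebra in dimension two\<close>

lemma dim_2_span:
  assumes W: "subspace W" "dim W = 2" and "x \<in> W" "y \<in> W" "z \<in> W"
    and ind: "\<And>\<alpha> \<beta>. \<alpha> \<cdot> x + \<beta> \<cdot> y = 0 \<Longrightarrow> \<alpha> = 0 \<and> \<beta> = 0"
  shows "\<exists>\<alpha> \<beta>. z = \<alpha> \<cdot> x + \<beta> \<cdot> y"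
proof -
  obtain T where T: "T \<subseteq> W" "independent T" "W \<subseteq> span T" "card T = dim W" using basis_exists[of W] by blast
  have finT: "finite T" using T(4) W(2) by (metis card.infinite zero_neq_numeral)
  have "y \<noteq> 0" using ind[of 0 1] by auto
  moreover have "x \<notin> span {y}"
  proof
    assume "x \<in> span {y}"
    then obtain c where "x = c \<cdot> y" by (auto simp: span_singleton)
    thus False using ind[of 1 "- c"] by simp
  qed
  ultimately have i2: "independent {x, y}" "x \<noteq> y" by (auto simp: independent_insert span_base)
  have "z \<in> span {x, y}"
  proof (rule ccontr)
    assume z: "z \<notin> span {x, y}"
    hence "independent {z, x, y}" using i2(1) by (simp add: independent_insertI)
    moreover have "{z, x, y} \<subseteq> span T" using assms T(3) by auto
    ultimately have "card {z, x, y} \<le> card T" using independent_span_bound[OF finT] by blast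
    moreover have "z \<noteq> x" "z \<noteq> y" using z span_base[of _ "{x, y}"] by auto
    ultimately show False using T(4) W(2) i2(2) by simp
  qed
  then obtain \<alpha> where "z - \<alpha> \<cdot> x \<in> span {y}" using span_breakdown_eq[of z x "{y}"] by auto
  then obtain \<beta> where "z - \<alpha> \<cdot> x = \<beta> \<cdot> y" by (auto simp: span_singleton)
  thus ?thesis by (metis add.commute diff_add_cancel)
qed

lemma eigenvectors_independent:
  assumes "md h n x = a \<cdot> x" "md h n y = b \<cdot> y" "a \<noteq> b" "x \<noteq> 0" "y \<noteq> 0"
    and "\<alpha> \<cdot> x + \<beta> \<cdot> y = 0"
  shows "\<alpha> = 0 \<and> \<beta> = 0"
proof -
  have "a \<cdot> (\<alpha> \<cdot> x + \<beta> \<cdot> y) - md h n (\<alpha> \<cdot> x + \<beta> \<cdot> y) = 0" using assms(6) by (simp add: mode_lin)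
  hence "(\<beta> * (a - b)) \<cdot> y = 0"
    using assms(1,2) by (simp add: mode_lin algebra_simps scale_right_distrib scale_left_diff_distrib)
  hence "\<beta> = 0" using assms(3,5) by simp
  thus ?thesis using assms by simp
qed

lemma eigenvector_exists:
  assumes W: "subspace W" "dim W = 2" and inv: "\<And>w. w \<in> W \<Longrightarrow> md h n w \<in> W"
    and w: "w \<in> W" "w \<noteq> 0"
  shows "\<exists>v\<in>W. v \<noteq> 0 \<and> (\<exists>r. md h n v = r \<cdot> v)"
proof (cases "\<exists>r. md h n w = r \<cdot> w")
  case False
  have ind: "\<alpha> = 0 \<and> \<beta> = 0" if 0: "\<alpha> \<cdot> w + \<beta> \<cdot> md h n w = 0" for \<alpha> \<beta>
  proof (cases "\<beta> = 0")
    case \<beta>: False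
    have "\<beta> \<cdot> md h n w = \<beta> \<cdot> ((- \<alpha> / \<beta>) \<cdot> w)"
      using 0 \<beta> by (simp add: eq_neg_iff_add_eq_0 add.commute)
    hence "md h n w = (- \<alpha> / \<beta>) \<cdot> w" using \<beta> scale_left_imp_eq by blast
    thus ?thesis using False by blast
  qed (use 0 w in auto)
  obtain p q where pq: "md h n (md h n w) = p \<cdot> w + q \<cdot> md h n w"
    using dim_2_span[OF W w(1) inv[OF w(1)] inv[OF inv[OF w(1)]] ind] by blast
  \<comment> \<open>A root of \<open>r^2 = q r + p\<close>. Then \<open>h^2 - q h - p\<close>
    factors as \<open>(h - r)(h - (q - r))\<close> and annihilates \<open>w\<close>, so
    \<open>(h - (q - r))w\<close> is an eigenvector for \<open>r\<close>.\<close>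
  define r where "r = (q + csqrt (q^2 + 4 * p)) / 2"
  have r: "r * (q - r) = - p"
  proof -
    have "(csqrt (q^2 + 4 * p))^2 = q^2 + 4 * p" by simp
    thus ?thesis unfolding r_def by (simp add: field_simps power2_eq_square)
  qed
  define v where "v = md h n w - (q - r) \<cdot> w"
  have "v \<in> W" unfolding v_def using W(1) w(1) inv by (simp add: subspace_diff subspace_scale)
  moreover have "v \<noteq> 0" using False by (auto simp: v_def)
  moreover have "md h n v = r \<cdot> v"
  proof -
    have p: "p = - (r * (q - r))" using r by simp
    show ?thesis by (simp add: v_def mode_lin pq p algebra_simps scale_right_diff_distrib scale_left_diff_distrib)
  qed
  ultimately show ?thesis by blast
qed (use w in blast)

section \<open>Generated subalgebras\<close>

lemma generated_closed: assumes u: "u \<in> S" and w: "w \<in> generated U S"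
  shows "md u n w \<in> generated U S"
proof -
  have "span (mode_words U S) \<subseteq> {w. md u n w \<in> generated U S}"
  proof (rule span_minimal)
    show "mode_words U S \<subseteq> {w. md u n w \<in> generated U S}"
      using u mode_words.mode_word[of u S] by (auto simp: generated_def intro: span_base)
  qed (auto simp: subspace_def mode_lin generated_def span_zero span_add span_scale)
  thus ?thesis using w unfolding generated_def by blast
qed

text \<open>Mode words are linear in each letter, so only the span of the generators matters. This
  allows the given generators to be replaced by weight bases.\<close>

lemma generated_mono_span:
  assumes "S \<subseteq> span S'"
  shows "generated U S \<subseteq> generated U S'"
proof -
  have lin: "md u n w \<in> generated U S'" if u: "u \<in> span S'" and w: "w \<in> generated U S'" for u n w
  proof -
    have "span S' \<subseteq> {u. md u n w \<in> generated U S'}"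
    proof (rule span_minimal)
      show "S' \<subseteq> {u. md u n w \<in> generated U S'}" using generated_closed w by blast
    qed (auto simp: subspace_def mode_lin generated_def span_zero span_add span_scale)
    thus ?thesis using u by blast
  qed
  have "w \<in> generated U S'" if "w \<in> mode_words U S" for w
    using that
  proof induction
    case vac_word
    show ?case unfolding generated_def by (intro span_base mode_words.vac_word)
  next
    case (mode_word u w n)
    thus ?case using lin assms by blast
  qed
  thus ?thesis unfolding generated_def[of U S] by (intro span_minimal) (auto simp: generated_def)
qed

lemma mode_span_mem: "u \<in> X \<Longrightarrow> v \<in> Y \<Longrightarrow> md u n v \<in> mode_span U X n Y"
  unfolding mode_span_def by (intro span_base) blast

end

section \<open>Consequences of CFT type\<close>

locale cft_svoa = svoa U for U :: "'v::ab_group_add svoa_data" +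
  assumes cft_type: "cft_type U"
begin

lemma wt_neg: "d < 0 \<Longrightarrow> v \<in> wt U d \<Longrightarrow> v = 0"
  using cft_type by (auto simp: cft_type_def)

lemma wt_0: "v \<in> wt U 0 \<Longrightarrow> v \<in> span {vac U}"
  using cft_type by (auto simp: cft_type_def)

lemma wt_0E: assumes "v \<in> wt U 0" obtains a where "v = a \<cdot> vac U"
  using wt_0[OF assms] by (auto simp: span_singleton)

lemma mode_eq_0: "u \<in> wt U d \<Longrightarrow> v \<in> wt U e \<Longrightarrow> d + e - 2 * n - 2 < 0 \<Longrightarrow> md u n v = 0"
  using wt_neg mode_wt by blast

text \<open>The bound on \<open>n\<close> makes the doubled weight of \<open>u(n + i)v\<close> at
  most 0 for \<open>i \<ge> 2\<close>, so these products are multiples of the vacuum. For two states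
  of weight 3/2 it covers every \<open>n \<ge> 0\<close>.\<close>

lemma skew_symmetry_low:
  assumes "u \<in> wt U d" "v \<in> wt U e" "2 * n \<ge> d + e - 6"
  shows "md v n u = - (((-1) powi n * sgn_wt d e) \<cdot> (md u n v - translation U (md u (n + 1) v)))"
proof (rule skew_symmetry[OF assms(1,2)])
  fix i :: nat assume i: "i \<ge> 2"
  show "md u (n + int i) v \<in> span {vac U}"
  proof (cases "d + e - 2 * (n + int i) - 2 = 0")
    case True thus ?thesis using mode_wt[OF assms(1,2) refl, of "n + int i"] wt_0 by auto
  next
    case False
    hence "md u (n + int i) v = 0" using i assms by (intro mode_eq_0[OF assms(1,2)]) auto
    thus ?thesis by (simp add: span_zero)
  qed
qed

lemma conf_translation: "md (conf U) n (translation U x)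
    = translation U (md (conf U) n x) + of_int n \<cdot> md (conf U) (n - 1) x"
  using translation_derivation[OF conf_weight, of n x] by simp

text \<open>On weight one \<open>L(1)T = 2L(0) + TL(1)\<close>, and \<open>TL(1)x = 0\<close>
  because \<open>L(1)x\<close> is a multiple of the vacuum. Hence
  \<open>L(1)Tx = 2x\<close>.\<close>

lemma translation_inj:
  assumes x: "x \<in> wt U 2" and "translation U x = 0"
  shows "x = 0"
proof -
  have "md (conf U) 2 x \<in> wt U 0" by (rule mode_wt[OF conf_weight x]) simp
  then obtain a where "md (conf U) 2 x = a \<cdot> vac U" by (rule wt_0E)
  thus ?thesis using conf_translation[of 2 x] assms(2)
    by (simp add: mode_lin translation_linear translation_vac conf_wt[OF x])
qed

section \<open>Doublets of odd generators\<close>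

text \<open>For \<open>n = 1\<close>, skew-symmetry and \<open>X(0)X = 0\<close> give
  \<open>T(X(1)X) = 0\<close>. For \<open>n = 2\<close> the product is a scalar-valued form that is
  symmetric and invariant under the zero modes of the currents; an invariant form on a doublet is
  antisymmetric, so it vanishes. For \<open>n \<ge> 3\<close> the weight is negative.\<close>

lemma doublet_products_zero:
  fixes X J :: "int \<Rightarrow> 'v"
  assumes X: "\<And>s. \<bar>s\<bar> = 1 \<Longrightarrow> X s \<in> wt U 3"
    and J: "J0 \<in> wt U 2" "\<And>s. \<bar>s\<bar> = 1 \<Longrightarrow> J s \<in> wt U 2"
    and J0X: "\<And>s. \<bar>s\<bar> = 1 \<Longrightarrow> md J0 0 (X s) = of_int s \<cdot> X s"
    and JX: "\<And>s. \<bar>s\<bar> = 1 \<Longrightarrow> md (J s) 0 (X (- s)) = X s"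
    and XX: "\<And>s t. \<bar>s\<bar> = 1 \<Longrightarrow> \<bar>t\<bar> = 1 \<Longrightarrow> md (X s) 0 (X t) = 0"
    and s: "\<bar>s\<bar> = 1" and t: "\<bar>t\<bar> = 1" and n: "n \<ge> 0"
  shows "md (X s) n (X t) = 0"
proof -
  consider "n = 0" | "n = 1" | "n = 2" | "n \<ge> 3" using n by linarith
  thus ?thesis
  proof cases
    case 1 thus ?thesis using XX s t by simp
  next
    case 2
    have "translation U (md (X s) 1 (X t)) = 0"
      using skew_symmetry_low[OF X[OF s] X[OF t], of 0] XX s t by (simp add: sgn_wt_simps)
    moreover have "md (X s) 1 (X t) \<in> wt U 2" by (rule mode_wt[OF X[OF s] X[OF t]]) simp
    ultimately show ?thesis using translation_inj 2 by blast
  next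
    case 3
    have vac: "md x 0 (md (X p) 2 (X q)) = 0" if "\<bar>p\<bar> = 1" "\<bar>q\<bar> = 1" for x p q
    proof -
      have "md (X p) 2 (X q) \<in> wt U 0" by (rule mode_wt[OF X[OF that(1)] X[OF that(2)]]) simp
      then obtain a where "md (X p) 2 (X q) = a \<cdot> vac U" by (rule wt_0E)
      thus ?thesis by (simp add: mode_lin creation_nonneg)
    qed
    show ?thesis
    proof (cases "t = s")
      case True
      have "0 = md (md J0 0 (X s)) 2 (X s) + md (X s) 2 (md J0 0 (X s))"
        using vac[OF s s, of J0] zero_mode_derivation[OF J(1) _ X[OF s], of 2 "X s"] by simp
      hence "of_int s \<cdot> md (X s) 2 (X s) = 0"
        using J0X[OF s] by (simp add: mode_lin double_eq_0)
      thus ?thesis using True 3 s by auto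
    next
      case False
      hence t': "t = - s" using s t by linarith
      have "0 = md (md (J s) 0 (X t)) 2 (X t) + md (X t) 2 (md (J s) 0 (X t))"
        using vac[OF t t, of "J s"] zero_mode_derivation[OF J(2)[OF s] _ X[OF t], of 2 "X t"] by simp
      hence "md (X s) 2 (X t) + md (X t) 2 (X s) = 0" using JX[OF s] t' by simp
      moreover have "md (X s) 3 (X t) = 0" by (rule mode_eq_0[OF X[OF s] X[OF t]]) simp
      hence "md (X t) 2 (X s) = md (X s) 2 (X t)"
        using skew_symmetry_low[OF X[OF s] X[OF t], of 2] by (simp add: sgn_wt_simps translation_linear)
      ultimately show ?thesis using 3 by (simp add: double_eq_0)
    qed
  next
    case 4 thus ?thesis by (intro mode_eq_0[OF X[OF s] X[OF t]]) simp
  qed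
qed

text \<open>\<open>X\<^sup>s(1)X\<^sup>t(1)Y\<^sup>r\<close> is antisymmetric in \<open>s, t\<close>, but it equals a multiple of \<open>X\<^sup>s(1)\<close> applied to a
  current; comparing the two orders leaves only zero.\<close>
lemma currents_primary_action:
  fixes X Y J :: "int \<Rightarrow> 'v"
  assumes X: "\<And>s. \<bar>s\<bar> = 1 \<Longrightarrow> X s \<in> wt U 3"
    and J: "J0 \<in> wt U 2" "\<And>s. \<bar>s\<bar> = 1 \<Longrightarrow> J s \<in> wt U 2"
    and XX: "\<And>s t n. \<bar>s\<bar> = 1 \<Longrightarrow> \<bar>t\<bar> = 1 \<Longrightarrow> n \<ge> 0 \<Longrightarrow> md (X s) n (X t) = 0"
    and XY: "\<And>s. \<bar>s\<bar> = 1 \<Longrightarrow> md (X s) 1 (Y s) = 2 \<cdot> J s"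
      "\<And>s. \<bar>s\<bar> = 1 \<Longrightarrow> md (X s) 1 (Y (- s)) = of_int s \<cdot> J0"
    and s: "\<bar>s\<bar> = 1" and t: "\<bar>t\<bar> = 1" and n: "n \<ge> 1"
  shows "md J0 n (X t) = 0" "md (J s) n (X t) = 0"
proof -
  have anti: "md (X p) 1 (md (X q) 1 w) = - md (X q) 1 (md (X p) 1 w)" if "\<bar>p\<bar> = 1" "\<bar>q\<bar> = 1" for p q w
    using commutator[OF X[OF that(1)] X[OF that(2)], of 0 1 1 w] XX[OF that]
    by (simp add: sgn_wt_simps eq_neg_iff_add_eq_0)
  have same: "md (X p) 1 (md (X p) 1 w) = 0" if "\<bar>p\<bar> = 1" for p w
    using anti[OF that that, of w] by (simp add: eq_neg_iff_add_eq_0 double_eq_0)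
  have XJ0: "md (X p) 1 J0 = 0" if p: "\<bar>p\<bar> = 1" for p
    using same[OF p, of "Y (- p)"] XY(2)[OF p] p by (auto simp: mode_lin)
  \<comment> \<open>For \<open>q = -p\<close>, exchanging the two odd modes brings
    \<open>X p\<close> next to \<open>Y (-p)\<close>; their product is a multiple of
    \<open>J0\<close>, which is already killed.\<close>
  have XJ: "md (X p) 1 (J q) = 0" if p: "\<bar>p\<bar> = 1" and q: "\<bar>q\<bar> = 1" for p q
  proof -
    have "md (X p) 1 (md (X q) 1 (Y q)) = 0"
    proof (cases "p = q")
      case False
      hence "q = - p" using p q by linarith
      thus ?thesis using anti[OF p q, of "Y q"] XY(2)[OF p] XJ0[OF q] by (simp add: mode_lin)
    qed (simp add: same q)
    thus ?thesis by (simp add: XY(1)[OF q] mode_lin)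
  qed
  have conv: "md j n (X t) = 0" if j: "j \<in> wt U 2" and "md (X t) 1 j = 0" for j
  proof (cases "n = 1")
    case True
    have "md (X t) 2 j = 0" by (rule mode_eq_0[OF X[OF t] j]) simp
    thus ?thesis using skew_symmetry_low[OF X[OF t] j, of 1] that True by (simp add: translation_linear)
  next
    case False
    thus ?thesis using n by (intro mode_eq_0[OF j X[OF t]]) simp
  qed
  show "md J0 n (X t) = 0" "md (J s) n (X t) = 0"
    using conv J XJ0 XJ s t by blast+
qed

end

section \<open>The doublets and currents in normalized form\<close>

locale n4_doublets = cft_svoa U for U :: "'v::ab_group_add svoa_data" +
  fixes G Gb J :: "int \<Rightarrow> 'v" and J0 :: 'v and k \<rho> :: complex
  assumes G_wt: "\<bar>s\<bar> = 1 \<Longrightarrow> G s \<in> wt U 3"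
    and Gb_wt: "\<bar>s\<bar> = 1 \<Longrightarrow> Gb s \<in> wt U 3"
    and J_wt: "\<bar>s\<bar> = 1 \<Longrightarrow> J s \<in> wt U 2" and J0_wt: "J0 \<in> wt U 2"
    and G_primary: "\<bar>s\<bar> = 1 \<Longrightarrow> n \<ge> 2 \<Longrightarrow> md (conf U) n (G s) = 0"
    and Gb_primary: "\<bar>s\<bar> = 1 \<Longrightarrow> n \<ge> 2 \<Longrightarrow> md (conf U) n (Gb s) = 0"
    and G0G: "\<bar>s\<bar> = 1 \<Longrightarrow> \<bar>t\<bar> = 1 \<Longrightarrow> md (G s) 0 (G t) = 0"
    and Gb0Gb: "\<bar>s\<bar> = 1 \<Longrightarrow> \<bar>t\<bar> = 1 \<Longrightarrow> md (Gb s) 0 (Gb t) = 0"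
    and J0_0_G: "\<bar>s\<bar> = 1 \<Longrightarrow> md J0 0 (G s) = of_int s \<cdot> G s"
    and J0_0_Gb: "\<bar>s\<bar> = 1 \<Longrightarrow> md J0 0 (Gb s) = of_int s \<cdot> Gb s"
    and J_0_G: "\<bar>s\<bar> = 1 \<Longrightarrow> md (J s) 0 (G s) = 0" "\<bar>s\<bar> = 1 \<Longrightarrow> md (J s) 0 (G (- s)) = G s"
    and J_0_Gb: "\<bar>s\<bar> = 1 \<Longrightarrow> md (J s) 0 (Gb s) = 0" "\<bar>s\<bar> = 1 \<Longrightarrow> md (J s) 0 (Gb (- s)) = - Gb s"
    and G1Gb: "\<bar>s\<bar> = 1 \<Longrightarrow> md (G s) 1 (Gb s) = 2 \<cdot> J s"
      "\<bar>s\<bar> = 1 \<Longrightarrow> md (G s) 1 (Gb (- s)) = of_int s \<cdot> J0"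
    and J0_0_J: "md J0 0 J0 = 0" "\<bar>s\<bar> = 1 \<Longrightarrow> md J0 0 (J s) = (2 * of_int s) \<cdot> J s"
    and J_0_J: "\<bar>s\<bar> = 1 \<Longrightarrow> md (J s) 0 (J s) = 0" "\<bar>s\<bar> = 1 \<Longrightarrow> md (J s) 0 (J (- s)) = of_int s \<cdot> J0"
    and J_0_J0: "\<bar>s\<bar> = 1 \<Longrightarrow> md (J s) 0 J0 = (- 2 * of_int s) \<cdot> J s"
    and J0_1_J: "md J0 1 J0 = (2 * k) \<cdot> vac U" "\<bar>s\<bar> = 1 \<Longrightarrow> md J0 1 (J s) = 0"
    and J_1_J: "\<bar>s\<bar> = 1 \<Longrightarrow> md (J s) 1 (J s) = 0" "\<bar>s\<bar> = 1 \<Longrightarrow> md (J s) 1 (J (- s)) = k \<cdot> vac U"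
    and J_nonzero: "J 1 \<noteq> 0"
    and TJ: "translation U (J 1) = \<rho> \<cdot> md (G 1) 0 (Gb 1)"
begin

lemma GG: "\<bar>s\<bar> = 1 \<Longrightarrow> \<bar>t\<bar> = 1 \<Longrightarrow> n \<ge> 0 \<Longrightarrow> md (G s) n (G t) = 0"
  by (rule doublet_products_zero[OF G_wt J0_wt J_wt J0_0_G J_0_G(2) G0G])

text \<open>The exchange \<open>(G\<^sup>s, Gb\<^sup>s) \<mapsto> (s Gb\<^sup>s, - s G\<^sup>s)\<close> preserves all relations between the currents and the doublets;
  it transfers results on \<open>G\<close> to \<open>Gb\<close>.\<close>
lemma GbGb: assumes "\<bar>s\<bar> = 1" "\<bar>t\<bar> = 1" "n \<ge> 0" shows "md (Gb s) n (Gb t) = 0"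
proof -
  have "md (of_int s \<cdot> Gb s) n (of_int t \<cdot> Gb t) = 0"
    by (rule doublet_products_zero[where X = "\<lambda>s. of_int s \<cdot> Gb s" and J = J and ?J0.0 = J0])
       (simp_all add: assms wt_lin Gb_wt J0_wt J_wt J0_0_Gb J_0_Gb Gb0Gb mode_lin)
  thus ?thesis using assms(1,2) by (auto simp: mode_lin)
qed

lemma J_n_G: assumes "\<bar>s\<bar> = 1" "\<bar>t\<bar> = 1" "n \<ge> 1"
  shows "md J0 n (G t) = 0" "md (J s) n (G t) = 0"
  by (rule currents_primary_action[where X = G and Y = Gb and J = J and ?J0.0 = J0];
    (rule G_wt J0_wt J_wt GG G1Gb assms; assumption?))+

lemma GbG: assumes "\<bar>s\<bar> = 1" "\<bar>t\<bar> = 1" "n \<ge> 0"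
  shows "md (Gb t) n (G s) = (-1) powi n \<cdot> (md (G s) n (Gb t) - translation U (md (G s) (n + 1) (Gb t)))"
  using skew_symmetry_low[OF G_wt[OF assms(1)] Gb_wt[OF assms(2)], of n] assms(3)
  by (simp add: sgn_wt_simps)

lemma T_G2Gb: assumes "\<bar>s\<bar> = 1" "\<bar>t\<bar> = 1" shows "translation U (md (G s) 2 (Gb t)) = 0"
proof -
  have "md (G s) 2 (Gb t) \<in> wt U 0" by (rule mode_wt[OF G_wt[OF assms(1)] Gb_wt[OF assms(2)]]) simp
  then obtain a where "md (G s) 2 (Gb t) = a \<cdot> vac U" by (rule wt_0E)
  thus ?thesis by (simp add: translation_linear translation_vac)
qed

lemma Gb1G: "\<bar>s\<bar> = 1 \<Longrightarrow> \<bar>t\<bar> = 1 \<Longrightarrow> md (Gb t) 1 (G s) = - md (G s) 1 (Gb t)"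
  using GbG[of s t 1] T_G2Gb by simp

lemma J_n_Gb: assumes "\<bar>s\<bar> = 1" "\<bar>t\<bar> = 1" "n \<ge> 1"
  shows "md J0 n (Gb t) = 0" "md (J s) n (Gb t) = 0"
proof -
  have 1: "of_int p \<cdot> Gb p \<in> wt U 3" if "\<bar>p\<bar> = 1" for p by (simp add: that wt_lin Gb_wt)
  have 2: "md (of_int p \<cdot> Gb p) n (of_int q \<cdot> Gb q) = 0" if "\<bar>p\<bar> = 1" "\<bar>q\<bar> = 1" "n \<ge> 0" for p q n
    by (simp add: that GbGb mode_lin)
  \<comment> \<open>The sign from reordering \<open>Gb\<close> and \<open>G\<close> cancels the
    signs put into the exchanged doublets, so the first products with the currents are the same as
    for \<open>G\<close> and \<open>Gb\<close>.\<close>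
  have 3: "md (of_int p \<cdot> Gb p) 1 (- (of_int p \<cdot> G p)) = 2 \<cdot> J p"
    "md (of_int p \<cdot> Gb p) 1 (- (of_int (- p) \<cdot> G (- p))) = of_int p \<cdot> J0" if p: "\<bar>p\<bar> = 1" for p
    using p G1Gb[of p] G1Gb[of "- p"] Gb1G[of p p] Gb1G[of "- p" p] by (auto simp: mode_lin abs_if split: if_splits)
  have "md J0 n (of_int t \<cdot> Gb t) = 0" "md (J s) n (of_int t \<cdot> Gb t) = 0"
    by (rule currents_primary_action[where X = "\<lambda>s. of_int s \<cdot> Gb s" and Y = "\<lambda>s. - (of_int s \<cdot> G s)"
        and J = J and ?J0.0 = J0]; (rule 1 2 3 J0_wt J_wt assms; assumption?))+
  thus "md J0 n (Gb t) = 0" "md (J s) n (Gb t) = 0" using assms(2) by (auto simp: mode_lin)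
qed

text \<open>The product \<open>G s (2) Gb s\<close> has \<open>J0\<close>-charge \<open>2s\<close>
  but lies in the span of the vacuum, of charge 0. For opposite signs, applying \<open>J0(1)\<close>
  to \<open>G s (1) Gb (-s) = s J0\<close> gives \<open>s G s (2) Gb (-s)\<close> on one side and
  \<open>2ks\<close> times the vacuum on the other.\<close>

lemma G2Gb: assumes s: "\<bar>s\<bar> = 1"
  shows "md (G s) 2 (Gb s) = 0" "md (G s) 2 (Gb (- s)) = (2 * k) \<cdot> vac U"
proof -
  have "md (G s) 2 (Gb s) \<in> wt U 0" by (rule mode_wt[OF G_wt[OF s] Gb_wt[OF s]]) simp
  then obtain a where a: "md (G s) 2 (Gb s) = a \<cdot> vac U" by (rule wt_0E)
  have "0 = md (md J0 0 (G s)) 2 (Gb s) + md (G s) 2 (md J0 0 (Gb s))"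
    using zero_mode_derivation[OF J0_wt _ G_wt[OF s], of 2 "Gb s"] by (simp add: a mode_lin creation_nonneg)
  hence "of_int s \<cdot> md (G s) 2 (Gb s) = 0"
    using s by (simp add: J0_0_G J0_0_Gb mode_lin double_eq_0)
  thus "md (G s) 2 (Gb s) = 0" using s by auto
  have "md J0 1 (md (G s) 1 (Gb (- s))) = md (md J0 0 (G s)) 2 (Gb (- s))"
    using commutator[OF J0_wt G_wt[OF s], of 1 1 1 "Gb (- s)"] s J_n_G(1)[OF s s] J_n_Gb(1)[OF s, of "- s" 1]
    by (simp add: sgn_wt_simps mode_lin)
  hence "of_int s \<cdot> md (G s) 2 (Gb (- s)) = of_int s \<cdot> ((2 * k) \<cdot> vac U)"
    using s by (simp add: G1Gb J0_0_G mode_lin J0_1_J)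
  thus "md (G s) 2 (Gb (- s)) = (2 * k) \<cdot> vac U"
    using s scale_cancel_left by (metis abs_0 of_int_eq_0_iff zero_neq_one)
qed

lemma odd_even_products: assumes s: "\<bar>s\<bar> = 1" and t: "\<bar>t\<bar> = 1"
  shows "md (G s) 0 (J t) = - md (J t) 0 (G s)" "md (Gb s) 0 (J t) = - md (J t) 0 (Gb s)"
    "md (Gb s) 1 (J t) = 0"
proof -
  show "md (G s) 0 (J t) = - md (J t) 0 (G s)"
    using skew_symmetry_low[OF J_wt[OF t] G_wt[OF s], of 0] J_n_G(2)[OF t s, of 1]
    by (simp add: sgn_wt_simps translation_linear)
  show "md (Gb s) 0 (J t) = - md (J t) 0 (Gb s)"
    using skew_symmetry_low[OF J_wt[OF t] Gb_wt[OF s], of 0] J_n_Gb(2)[OF t s, of 1]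
    by (simp add: sgn_wt_simps translation_linear)
  show "md (Gb s) 1 (J t) = 0"
    using skew_symmetry_low[OF J_wt[OF t] Gb_wt[OF s], of 1] J_n_Gb(2)[OF t s, of 1] J_n_Gb(2)[OF t s, of 2]
    by (simp add: sgn_wt_simps translation_linear)
qed

text \<open>Every current is, up to a scalar, a product \<open>G(1)Gb\<close>. On it
  \<open>L(1)\<close> acts with coefficient \<open>2 * (3/2) - 3 = 0\<close>, and the higher
  Virasoro modes lower the weight below zero.\<close>

lemma conf_J: assumes "n \<ge> 2"
  shows "md (conf U) n J0 = 0" "\<bar>s\<bar> = 1 \<Longrightarrow> md (conf U) n (J s) = 0"
proof -
  have *: "md (conf U) n (md (G s) 1 (Gb t)) = 0" if "\<bar>s\<bar> = 1" "\<bar>t\<bar> = 1" for s t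
  proof (cases "n = 2")
    case True
    thus ?thesis using conf_primary_commutator[OF G_wt[OF that(1)], of 2 1 "Gb t"] that
      by (simp add: G_primary Gb_primary mode_lin)
  next
    case False
    show ?thesis
      by (rule mode_eq_0[OF conf_weight mode_wt[OF G_wt[OF that(1)] Gb_wt[OF that(2)] refl]])
         (use False assms in simp)
  qed
  show "md (conf U) n J0 = 0" using *[of 1 "- 1"] G1Gb(2)[of 1] by (simp add: mode_lin)
  show "md (conf U) n (J s) = 0" if "\<bar>s\<bar> = 1" using *[OF that that] G1Gb(1)[OF that] by (simp add: mode_lin)
qed

text \<open>\<open>L(1)\<close> sends both \<open>G 1 (0) Gb 1\<close> and \<open>T(J 1)\<close> to
  \<open>2 J 1\<close>, which is nonzero. Hence the factor \<open>\<rho>\<close> is 1.\<close>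

lemma G0Gb_highest: "md (G 1) 0 (Gb 1) = translation U (J 1)"
proof -
  have "md (conf U) 2 (md (G 1) 0 (Gb 1)) = 2 \<cdot> J 1"
    using conf_primary_commutator[OF G_wt, of 1 2 0 "Gb 1"]
    by (simp add: G_primary Gb_primary mode_lin G1Gb)
  moreover have "md (conf U) 2 (translation U (J 1)) = 2 \<cdot> J 1"
    by (simp add: conf_translation conf_J translation_linear conf_wt[OF J_wt])
  ultimately have "2 \<cdot> J 1 = (\<rho> * 2) \<cdot> J 1" by (simp add: TJ mode_lin)
  hence "\<rho> = 1" using J_nonzero by simp
  thus ?thesis using TJ by simp
qed

text \<open>This is \<open>G0Gb_highest\<close> lowered once by \<open>J (-1)\<close>. The minus
  sign in the action on \<open>Gb\<close> turns the two terms of the Leibniz rule into a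
  difference.\<close>

lemma G0Gb_middle: "md (G 1) 0 (Gb (- 1)) - md (G (- 1)) 0 (Gb 1) = translation U J0"
proof -
  have "md (J (- 1)) 0 (md (G 1) 0 (Gb 1)) = md (G (- 1)) 0 (Gb 1) - md (G 1) 0 (Gb (- 1))"
    using zero_mode_derivation[OF J_wt _ G_wt, of "- 1" 1 0 "Gb 1"] J_0_G(2)[of "- 1"] J_0_Gb(2)[of "- 1"]
    by (simp add: mode_lin)
  moreover have "md (J (- 1)) 0 (translation U (J 1)) = - translation U J0"
    using zero_mode_translation[OF J_wt, of "- 1"] J_0_J(2)[of "- 1"] by (simp add: translation_linear)
  ultimately show ?thesis using G0Gb_highest by (metis minus_diff_eq minus_minus)
qed

lemma G0Gb_lowest: "md (G (- 1)) 0 (Gb (- 1)) = translation U (J (- 1))"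
proof -
  have "md (J (- 1)) 0 (md (G 1) 0 (Gb (- 1))) = md (G (- 1)) 0 (Gb (- 1))"
    "md (J (- 1)) 0 (md (G (- 1)) 0 (Gb 1)) = - md (G (- 1)) 0 (Gb (- 1))"
    using zero_mode_derivation[OF J_wt _ G_wt, of "- 1" 1 0 "Gb (- 1)"]
      zero_mode_derivation[OF J_wt _ G_wt, of "- 1" "- 1" 0 "Gb 1"]
      J_0_G[of "- 1"] J_0_Gb[of "- 1"]
    by (simp_all add: mode_lin)
  moreover have "md (J (- 1)) 0 (translation U J0) = 2 \<cdot> translation U (J (- 1))"
    using zero_mode_translation[OF J_wt, of "- 1"] J_0_J0[of "- 1"] by (simp add: translation_linear)
  ultimately have "2 \<cdot> md (G (- 1)) 0 (Gb (- 1)) = 2 \<cdot> translation U (J (- 1))"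
    using arg_cong[OF G0Gb_middle, of "md (J (- 1)) 0"]
    by (simp add: mode_lin double_scale)
  thus ?thesis by simp
qed

lemma G0Gb_same: "\<bar>s\<bar> = 1 \<Longrightarrow> md (G s) 0 (Gb s) = translation U (J s)"
  using G0Gb_highest G0Gb_lowest by (auto simp: abs_if split: if_splits)

text \<open>By \<open>G0Gb_middle\<close> this is the average of \<open>G 1 (0) Gb (-1)\<close> and
  \<open>G (-1) (0) Gb 1\<close>.\<close>

definition \<omega> where "\<omega> = md (G 1) 0 (Gb (- 1)) - (1 / 2) \<cdot> translation U J0"

lemma omega_eq: assumes "\<bar>s\<bar> = 1"
  shows "\<omega> = md (G s) 0 (Gb (- s)) - (of_int s / 2) \<cdot> translation U J0"
proof -
  have "s = 1 \<or> s = -1" using assms by linarith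
  moreover have "md (G 1) 0 (Gb (- 1)) = md (G (- 1)) 0 (Gb 1) + translation U J0"
    using G0Gb_middle by (simp add: algebra_simps)
  moreover have "translation U J0 - (1 / 2) \<cdot> translation U J0 = (1 / 2) \<cdot> translation U J0"
    using scale_left_diff_distrib[of 1 "1/2" "translation U J0"] by simp
  ultimately show ?thesis by (auto simp: \<omega>_def algebra_simps)
qed

lemma omega_wt: "\<omega> \<in> wt U 4"
proof -
  have "md (G 1) 0 (Gb (- 1)) \<in> wt U 4" by (rule mode_wt[OF G_wt Gb_wt]) auto
  thus ?thesis using translation_wt[OF J0_wt] by (simp add: \<omega>_def wt_lin)
qed

text \<open>\<open>G s (0)\<close> is an odd derivation, so the modes of
  \<open>G s (0) Gb (-s)\<close> are anticommutators, and \<open>(T J0)(n) = -n J0(n - 1)\<close>.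
  Either sign \<open>s\<close> may be used, which leaves a choice in the computations that
  follow.\<close>

lemma omega_mode: assumes s: "\<bar>s\<bar> = 1"
  shows "md \<omega> n w = md (G s) 0 (md (Gb (- s)) n w) + md (Gb (- s)) n (md (G s) 0 w)
     + (of_int s * of_int n / 2) \<cdot> md J0 (n - 1) w"
  using zero_mode_bracket[OF G_wt[OF s] Gb_wt, of "- s" n w] s
  by (simp add: omega_eq[OF s] mode_lin sgn_wt_simps mode_translation[OF J0_wt])

text \<open>The presentation of \<open>\<omega>\<close> with sign \<open>-s\<close> makes the term
  containing \<open>G (-s) (0) G s\<close> vanish. At \<open>n = 1\<close> the remaining terms
  contribute \<open>2\<close> and \<open>-1/2\<close>, which add up to the weight 3/2.\<close>

lemma omega_G: assumes s: "\<bar>s\<bar> = 1" and n: "n \<ge> 0"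
  shows "md \<omega> n (G s) = md (conf U) n (G s)"
proof -
  have m: "\<bar>- s\<bar> = 1" using s by simp
  have e: "md \<omega> n (G s) = md (G (- s)) 0 (md (Gb s) n (G s)) - (of_int s * of_int n / 2) \<cdot> md J0 (n - 1) (G s)"
    using omega_mode[OF m, of n "G s"] s by (simp add: GG mode_lin)
  have G0J: "md (G (- s)) 0 (J s) = - G s" using odd_even_products(1)[OF m s] J_0_G(2)[OF s] by simp
  have T: "translation U (md (G (- s)) 0 (J s)) = md (G (- s)) 0 (translation U (J s))"
    using zero_mode_translation[OF G_wt[OF m]] by simp
  consider "n = 0" | "n = 1" | "n = 2" | "n \<ge> 3" using n by linarith
  thus ?thesis
  proof cases
    case 1
    have "md (Gb s) 0 (G s) = - translation U (J s)"
      using GbG[OF s s, of 0] G0Gb_same[OF s] G1Gb(1)[OF s]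
      by (simp add: translation_linear double_scale)
    hence "md \<omega> n (G s) = translation U (G s)" using e T G0J 1 by (simp add: mode_lin translation_linear) (metis minus_minus)
    thus ?thesis using 1 by (simp add: translation_eq_conf)
  next
    case 2
    have "md \<omega> 1 (G s) = 2 \<cdot> G s - (of_int s * of_int s / 2) \<cdot> G s"
      using e G0J s 2 by (simp add: Gb1G G1Gb mode_lin J0_0_G)
    moreover have "of_int s * of_int s = (1::complex)" using s by (auto simp: abs_if split: if_splits)
    ultimately show ?thesis using 2 conf_wt[OF G_wt[OF s]]
      by (simp add: scale_left_diff_distrib[symmetric])
  next
    case 3
    have "md (Gb s) 2 (G s) = 0"
      using GbG[OF s s, of 2] G2Gb(1)[OF s] mode_eq_0[OF G_wt[OF s] Gb_wt[OF s], of 3]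
      by (simp add: translation_linear)
    thus ?thesis using e 3 J_n_G(1)[OF s s, of 1] G_primary[OF s] by (simp add: mode_lin)
  next
    case 4
    hence "md \<omega> n (G s) = 0" by (intro mode_eq_0[OF omega_wt G_wt[OF s]]) simp
    thus ?thesis using 4 G_primary[OF s] by simp
  qed
qed

text \<open>Here the sign \<open>s\<close> itself is used: the term with
  \<open>Gb (-s) (n) Gb s\<close> vanishes and the other one contains
  \<open>G s (0) Gb s = T(J s)\<close>. At \<open>n = 1\<close> the contributions are
  \<open>1\<close> and \<open>1/2\<close>.\<close>

lemma omega_Gb: assumes s: "\<bar>s\<bar> = 1" and n: "n \<ge> 0"
  shows "md \<omega> n (Gb s) = md (conf U) n (Gb s)"
proof -
  have m: "\<bar>- s\<bar> = 1" using s by simp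
  have e: "md \<omega> n (Gb s) = md (Gb (- s)) n (translation U (J s)) + (of_int s * of_int n / 2) \<cdot> md J0 (n - 1) (Gb s)"
    using omega_mode[OF s, of n "Gb s"] GbGb[OF m s n] G0Gb_same[OF s] by (simp add: mode_lin)
  have Gb0J: "md (Gb (- s)) 0 (J s) = Gb s" using odd_even_products(2)[OF m s] J_0_Gb(2)[OF s] by simp
  have Gb1J: "md (Gb (- s)) 1 (J s) = 0" using odd_even_products(3)[OF m s] .
  have Gb2J: "md (Gb (- s)) 2 (J s) = 0" by (rule mode_eq_0[OF Gb_wt[OF m] J_wt[OF s]]) simp
  have T: "md (Gb (- s)) n (translation U (J s))
      = translation U (md (Gb (- s)) n (J s)) + of_int n \<cdot> md (Gb (- s)) (n - 1) (J s)"
    using translation_derivation[OF Gb_wt[OF m], of n "J s"] by simp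
  consider "n = 0" | "n = 1" | "n = 2" | "n \<ge> 3" using n by linarith
  thus ?thesis
  proof cases
    case 1
    thus ?thesis using e T Gb0J by (simp add: translation_eq_conf)
  next
    case 2
    have "md \<omega> 1 (Gb s) = Gb s + (of_int s * of_int s / 2) \<cdot> Gb s"
      using e T Gb0J Gb1J s 2 by (simp add: translation_linear J0_0_Gb)
    moreover have "of_int s * of_int s = (1::complex)" using s by (auto simp: abs_if split: if_splits)
    ultimately show ?thesis using 2 conf_wt[OF Gb_wt[OF s]] scale_left_distrib[of 1 "1/2" "Gb s"]
      by simp
  next
    case 3
    thus ?thesis using e T Gb1J Gb2J J_n_Gb(1)[OF s s, of 1] Gb_primary[OF s] by (simp add: mode_lin translation_linear)
  next
    case 4
    hence "md \<omega> n (Gb s) = 0" by (intro mode_eq_0[OF omega_wt Gb_wt[OF s]]) simp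
    thus ?thesis using 4 Gb_primary[OF s] by simp
  qed
qed

section \<open>The new Virasoro element on the generated subalgebra\<close>

abbreviation "gens \<equiv> {G 1, G (- 1), Gb 1, Gb (- 1)}"

lemma gens_wt: "x \<in> gens \<Longrightarrow> x \<in> wt U 3"
  using G_wt[of 1] G_wt[of "- 1"] Gb_wt[of 1] Gb_wt[of "- 1"] by auto

lemma gens_I: "\<bar>s\<bar> = 1 \<Longrightarrow> G s \<in> gens" "\<bar>s\<bar> = 1 \<Longrightarrow> Gb s \<in> gens"
  by (auto simp: abs_if split: if_splits)

lemma omega_gens: "x \<in> gens \<Longrightarrow> n \<ge> 0 \<Longrightarrow> md \<omega> n x = md (conf U) n x"
  using omega_G[of 1 n] omega_G[of "- 1" n] omega_Gb[of 1 n] omega_Gb[of "- 1" n] by auto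

text \<open>The difference of the two conformal vectors has no singular products with the generators, so
  its modes commute with theirs, and its nonnegative modes kill everything the generators create from the vacuum.\<close>
lemma omega_eq_conf_on_generated:
  assumes w: "w \<in> generated U gens" and n: "n \<ge> 0"
  shows "md \<omega> n w = md (conf U) n w"
proof -
  have words: "md \<omega> n w = md (conf U) n w" if "w \<in> mode_words U gens" for w
    using that
  proof induction
    case vac_word
    show ?case using n by (simp add: creation_nonneg)
  next
    case (mode_word x w m)
    obtain N N' where N: "\<forall>i\<ge>N. md \<omega> (int i) x = 0" "\<forall>i\<ge>N'. md (conf U) (int i) x = 0"
      using truncation_nat by meson
    have "md \<omega> n (md x m w) - md x m (md \<omega> n w) = md (conf U) n (md x m w) - md x m (md (conf U) n w)"
      using commutator[OF omega_wt gens_wt, of x "N + N'" n m w] commutator[OF conf_weight gens_wt, of x "N + N'" n m w]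
        mode_word N omega_gens[of x] by (simp add: sgn_wt_simps)
    thus ?case using mode_word by simp
  qed
  have "generated U gens \<subseteq> {w. md \<omega> n w = md (conf U) n w}"
    unfolding generated_def by (rule span_minimal) (auto simp: words subspace_def mode_lin)
  thus ?thesis using w by blast
qed

lemma generated_lin:
  "x \<in> generated U gens \<Longrightarrow> y \<in> generated U gens \<Longrightarrow> x + y \<in> generated U gens"
  "x \<in> generated U gens \<Longrightarrow> y \<in> generated U gens \<Longrightarrow> x - y \<in> generated U gens"
  "x \<in> generated U gens \<Longrightarrow> a \<cdot> x \<in> generated U gens"
  by (simp_all add: generated_def span_add span_scale span_diff)

lemma gens_generated: "x \<in> gens \<Longrightarrow> x \<in> generated U gens"
  using generated_closed[of x gens "vac U" "- 1"] by (auto simp: creation generated_def intro: span_base mode_words.vac_word)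

lemma J_generated: "\<bar>s\<bar> = 1 \<Longrightarrow> J s \<in> generated U gens" and J0_generated: "J0 \<in> generated U gens"
proof -
  have *: "md (G s) n (Gb t) \<in> generated U gens" if "\<bar>s\<bar> = 1" "\<bar>t\<bar> = 1" for s t n
    using that gens_I generated_closed gens_generated by blast
  show "J0 \<in> generated U gens" using *[of 1 "- 1" 1] G1Gb(2)[of 1] by simp
  assume s: "\<bar>s\<bar> = 1"
  have "J s = (1 / 2) \<cdot> md (G s) 1 (Gb s)" using G1Gb(1)[OF s] by simp
  thus "J s \<in> generated U gens" using *[OF s s, of 1] generated_lin(3) by metis
qed

lemma omega_generated: "\<omega> \<in> generated U gens"
proof -
  have *: "md (G s) n (Gb t) \<in> generated U gens" if "\<bar>s\<bar> = 1" "\<bar>t\<bar> = 1" for s t n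
    using that gens_I generated_closed gens_generated by blast
  \<comment> \<open>Writing \<open>T J0\<close> as a difference of products \<open>G(0)Gb\<close>
    makes \<open>\<omega>\<close> a combination of generators acting on generators.\<close>
  show ?thesis unfolding \<omega>_def G0Gb_middle[symmetric] by (intro generated_lin *) auto
qed

text \<open>Since \<open>\<omega>\<close> lies in the generated subalgebra,
  \<open>\<omega>(n)\<close> may be replaced by \<open>conf(n)\<close> here, and the primary
  commutators apply. The fourth-order pole comes from \<open>(3/2) G 1 (2) Gb (-1)\<close>; its
  coefficient \<open>3k\<close> is \<open>c/2\<close> with \<open>c = 6k\<close>.\<close>

lemma omega_omega:
  "md \<omega> 0 \<omega> = translation U \<omega>" "md \<omega> 1 \<omega> = 2 \<cdot> \<omega>" "md \<omega> 2 \<omega> = 0"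
  "md \<omega> 3 \<omega> = (3 * k) \<cdot> vac U" "n \<ge> 4 \<Longrightarrow> md \<omega> n \<omega> = 0"
proof -
  note eq = omega_eq_conf_on_generated[OF omega_generated]
  have c: "md (conf U) n \<omega> = (of_int n / 2) \<cdot> md (G 1) (n - 1) (Gb (- 1)) - (of_int n / 2) \<cdot> md (conf U) (n - 1) J0"
    if n: "n \<ge> 2" for n
  proof -
    have "md (conf U) n (md (G 1) 0 (Gb (- 1))) = (of_int n / 2) \<cdot> md (G 1) (n - 1) (Gb (- 1))"
      using conf_primary_commutator[OF G_wt, of 1 n 0 "Gb (- 1)"] n
      by (simp add: G_primary Gb_primary mode_lin field_simps)
    moreover have "md (conf U) n (translation U J0) = of_int n \<cdot> md (conf U) (n - 1) J0"
      using n by (simp add: conf_translation conf_J translation_linear)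
    ultimately show ?thesis by (simp add: \<omega>_def mode_lin)
  qed
  show "md \<omega> 0 \<omega> = translation U \<omega>" using eq[of 0] by (simp add: translation_eq_conf)
  show "md \<omega> 1 \<omega> = 2 \<cdot> \<omega>" using eq[of 1] by (simp add: conf_wt[OF omega_wt])
  show "md \<omega> 2 \<omega> = 0" using eq[of 2] c[of 2] G1Gb(2)[of 1] by (simp add: conf_wt[OF J0_wt])
  show "md \<omega> 3 \<omega> = (3 * k) \<cdot> vac U" using eq[of 3] c[of 3] G2Gb(2)[of 1] by (simp add: conf_J)
  show "md \<omega> n \<omega> = 0" if "n \<ge> 4" using that by (intro mode_eq_0[OF omega_wt omega_wt]) simp
qed

lemma gbinomial_shift_3: "((of_int m + 1 :: complex) gchoose 3) = of_int (m ^ 3 - m) / 6"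
  by (simp add: gbinomial_prod_rev eval_nat_numeral field_simps)

text \<open>The Virasoro brackets are computed from the products \<open>\<omega>(n)\<omega>\<close>,
  since only the nonnegative modes are compared with those of \<open>conf U\<close>. That comparison
  supplies \<open>L(0)\<close> and \<open>L(-1)\<close> on the subalgebra.\<close>

lemma omega_virasoro: "virasoro_element U (generated U gens) \<omega> (6 * k)"
proof -
  have "vir U \<omega> m (vir U \<omega> n v) - vir U \<omega> n (vir U \<omega> m v)
      = of_int (m - n) \<cdot> vir U \<omega> (m + n) v + (if m + n = 0 then (of_int (m ^ 3 - m) / 12 * (6 * k)) \<cdot> v else 0)" for m n v
  proof -
    have "md \<omega> (m + 1) (md \<omega> (n + 1) v) - md \<omega> (n + 1) (md \<omega> (m + 1) v)
       = md (translation U \<omega>) (m + n + 2) v + (2 * (of_int m + 1)) \<cdot> md \<omega> (m + n + 1) v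
         + ((of_int m + 1 gchoose 3) * (3 * k)) \<cdot> md (vac U) (m + n - 1) v"
      using commutator[OF omega_wt omega_wt, of 4 "m + 1" "n + 1" v] omega_omega
      by (simp add: sgn_wt_simps eval_nat_numeral mode_lin algebra_simps)
    also have "md (translation U \<omega>) (m + n + 2) v = (- of_int (m + n + 2)) \<cdot> md \<omega> (m + n + 1) v"
      using mode_translation[OF omega_wt, of "m + n + 2" v] by (simp add: algebra_simps)
    also have "(- of_int (m + n + 2)) \<cdot> md \<omega> (m + n + 1) v + (2 * (of_int m + 1)) \<cdot> md \<omega> (m + n + 1) v
        = of_int (m - n) \<cdot> md \<omega> (m + n + 1) v"
      by (simp add: scale_left_distrib[symmetric])
    finally show ?thesis by (simp add: vir_def vac_mode gbinomial_shift_3 mode_lin add.assoc)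
  qed
  thus ?thesis
    using omega_wt omega_generated omega_eq_conf_on_generated[of _ 1] omega_eq_conf_on_generated[of _ 0]
    by (auto simp: virasoro_element_def virasoro_relations_def vir_def conf_wt translation_eq_conf)
qed

lemma n4_algebra:
  assumes "distinct [G 1, G (- 1), Gb 1, Gb (- 1)]"
  shows "N4_algebra U (generated U gens) (6 * k)"
proof -
  \<comment> \<open>Positive Virasoro modes are modes with index at least 2, where
    \<open>\<omega>\<close> and \<open>conf U\<close> agree on these states.\<close>
  have prim: "primary U \<omega> 2 J0" "\<bar>s\<bar> = 1 \<Longrightarrow> primary U \<omega> 2 (J s)"
    "\<bar>s\<bar> = 1 \<Longrightarrow> primary U \<omega> 3 (G s)" "\<bar>s\<bar> = 1 \<Longrightarrow> primary U \<omega> 3 (Gb s)" for s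
    using omega_eq_conf_on_generated[OF J0_generated] omega_eq_conf_on_generated[OF J_generated, of s] conf_J
      omega_G omega_Gb G_primary Gb_primary
    by (auto simp: primary_def vir_def J0_wt J_wt G_wt Gb_wt)
  have high: "n \<ge> 2 \<Longrightarrow> md J0 n J0 = 0" "n \<ge> 2 \<Longrightarrow> md (J 1) n (J (- 1)) = 0"
    "\<bar>s\<bar> = 1 \<Longrightarrow> n \<ge> 2 \<Longrightarrow> md J0 n (J s) = 0" "\<bar>s\<bar> = 1 \<Longrightarrow> n \<ge> 2 \<Longrightarrow> md (J s) n (J s) = 0"
    "\<bar>s\<bar> = 1 \<Longrightarrow> \<bar>t\<bar> = 1 \<Longrightarrow> n \<ge> 3 \<Longrightarrow> md (G s) n (Gb t) = 0" for s t n
    by (rule mode_eq_0[of _ 2 _ 2] mode_eq_0[of _ 3 _ 3]; simp add: J0_wt J_wt G_wt Gb_wt)+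
  have ge1: "n = 1 \<or> n \<ge> 2" if "n \<ge> 1" for n :: int using that by linarith
  have ge0: "n = 0 \<or> n \<ge> 1" if "n \<ge> 0" for n :: int using that by linarith
  have ge2: "n = 2 \<or> n \<ge> 3" if "n \<ge> 2" for n :: int using that by linarith
  have om: "md (G s) 0 (Gb (- s)) = \<omega> + (of_int s / 2) \<cdot> translation U J0" if "\<bar>s\<bar> = 1" for s
    using omega_eq[OF that] by simp
  have A: "md J0 n J0 = 0" if "n \<ge> 0" "n \<noteq> 1" for n using ge0[OF that(1)] ge1[of n] that J0_0_J(1) high(1) by auto
  have B: "md J0 n (J s) = 0" if "\<bar>s\<bar> = 1" "n \<ge> 1" for s n using ge1[OF that(2)] that J0_1_J(2) high(3) by auto
  have C: "md (J s) n (J s) = 0" if "\<bar>s\<bar> = 1" "n \<ge> 0" for s n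
    using ge0[OF that(2)] ge1[of n] that J_0_J(1) J_1_J(1) high(4) by auto
  have D: "md (J s) n (G s) = 0" "md (J s) n (Gb s) = 0" if "\<bar>s\<bar> = 1" "n \<ge> 0" for s n
    using ge0[OF that(2)] that J_0_G(1) J_0_Gb(1) J_n_G(2) J_n_Gb(2) by auto
  have E: "md (G s) n (Gb s) = 0" if "\<bar>s\<bar> = 1" "n \<ge> 2" for s n
    using ge2[OF that(2)] that G2Gb(1) high(5) by auto
  have pm: "s \<in> {1, - 1} \<Longrightarrow> \<bar>s\<bar> = 1" for s :: int by auto
  show ?thesis unfolding N4_algebra_def
    by (rule exI[of _ G], rule exI[of _ Gb], rule exI[of _ J], rule exI[of _ J0], rule exI[of _ \<omega>],
      intro conjI ballI allI impI; (drule pm)?)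
     (simp_all only: assms omega_virasoro J0_generated J_generated prim J0_0_J J_0_G J_0_Gb G1Gb G2Gb G0Gb_same
       om A B C D E GG GbGb J_n_G J_n_Gb high J0_0_G J0_0_Gb J_1_J J_0_J J0_1_J abs_minus_cancel abs_one,
      simp_all add: A J0_0_J J_1_J J_0_J J0_1_J)
qed

end

section \<open>The Lie algebra of currents and its vector representations\<close>

definition sl2_e :: "complex^2^2" where "sl2_e = vector [vector [0, 1], vector [0, 0]]"
definition sl2_f :: "complex^2^2" where "sl2_f = vector [vector [0, 0], vector [1, 0]]"

lemmas matrix_2_simps = vec_eq_iff forall_2 matrix_matrix_mult_def sum_2 trace_def mat_def vector_2
  sl2_def sl2_cartan_def sl2_e_def sl2_f_def

lemma sl2_decompose: "M \<in> sl2 \<Longrightarrow> M = mat (M$1$2) ** sl2_e + (mat (M$1$1) ** sl2_cartan + mat (M$2$1) ** sl2_f)"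
  by (simp add: matrix_2_simps add_eq_0_iff)

lemma sl2_mem: "sl2_e \<in> sl2" "sl2_f \<in> sl2" "sl2_cartan \<in> sl2"
  "M \<in> sl2 \<Longrightarrow> N \<in> sl2 \<Longrightarrow> M + N \<in> sl2" "M \<in> sl2 \<Longrightarrow> mat a ** M \<in> sl2"
  "M ** N - N ** M \<in> sl2"
  by (simp_all add: matrix_2_simps distrib_left[symmetric] add_eq_0_iff)

text \<open>Each right side has the form \<open>mat a ** M\<close>, even for \<open>a = 1\<close>,
  so that the homogeneity clause of \<open>sl2_iso\<close> applies uniformly.\<close>

lemma sl2_brackets:
  "sl2_cartan ** sl2_e - sl2_e ** sl2_cartan = mat 2 ** sl2_e"
  "sl2_cartan ** sl2_f - sl2_f ** sl2_cartan = mat (- 2) ** sl2_f"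
  "sl2_e ** sl2_f - sl2_f ** sl2_e = mat 1 ** sl2_cartan"
  "sl2_e ** sl2_cartan - sl2_cartan ** sl2_e = mat (- 2) ** sl2_e"
  "sl2_f ** sl2_cartan - sl2_cartan ** sl2_f = mat 2 ** sl2_f"
  "sl2_f ** sl2_e - sl2_e ** sl2_f = mat (- 1) ** sl2_cartan"
  by (simp_all add: matrix_2_simps)

text \<open>The trace form gives the Cartan element norm 2, which is the normalization in
  \<open>level\<close>.\<close>

lemma sl2_trace:
  assumes "M \<in> sl2" "N \<in> sl2"
  shows "trace (M ** N) = 2 * (M$1$1 * N$1$1) + M$1$2 * N$2$1 + M$2$1 * N$1$2"
  using assms by (simp add: matrix_2_simps add_eq_0_iff)

lemma trace_invariant: "trace ((X ** Y - Y ** X) ** Z) = trace (X ** (Y ** Z - Z ** Y))" for X :: "complex^2^2"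
  by (simp add: matrix_2_simps algebra_simps)

section \<open>Currents spanning a copy of \<open>sl2\<close>\<close>

locale sl2_currents = cft_svoa U for U :: "'v::ab_group_add svoa_data" +
  fixes e h f :: 'v and g :: "'v set"
  assumes ehf_wt: "e \<in> wt U 2" "h \<in> wt U 2" "f \<in> wt U 2"
    and brackets: "md e 0 e = 0" "md e 0 h = (- 2) \<cdot> e" "md e 0 f = h"
      "md h 0 e = 2 \<cdot> e" "md h 0 h = 0" "md h 0 f = (- 2) \<cdot> f"
      "md f 0 e = - h" "md f 0 h = 2 \<cdot> f" "md f 0 f = 0"
    and ehf_independent: "\<alpha> \<cdot> e + \<beta> \<cdot> h + \<gamma> \<cdot> f = 0 \<Longrightarrow> \<alpha> = 0 \<and> \<beta> = 0 \<and> \<gamma> = 0"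
    and g_iff: "x \<in> g \<longleftrightarrow> (\<exists>\<alpha> \<beta> \<gamma>. x = \<alpha> \<cdot> e + \<beta> \<cdot> h + \<gamma> \<cdot> f)"
begin

lemma ehf_nonzero: "e \<noteq> 0" "h \<noteq> 0" "f \<noteq> 0"
  using ehf_independent[of 1 0 0] ehf_independent[of 0 1 0] ehf_independent[of 0 0 1] by auto

lemma ehf_g: "e \<in> g" "h \<in> g" "f \<in> g"
proof -
  show "e \<in> g" unfolding g_iff by (rule exI[of _ 1], rule exI[of _ 0], rule exI[of _ 0]) simp
  show "h \<in> g" unfolding g_iff by (rule exI[of _ 0], rule exI[of _ 1], rule exI[of _ 0]) simp
  show "f \<in> g" unfolding g_iff by (rule exI[of _ 0], rule exI[of _ 0], rule exI[of _ 1]) simp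
qed

lemmas ehf_derivation = zero_mode_derivation[OF ehf_wt(1)] zero_mode_derivation[OF ehf_wt(2)]
  zero_mode_derivation[OF ehf_wt(3)]

lemma weight_vectors_in_g:
  assumes "x \<in> g"
  shows "md h 0 x = 2 \<cdot> x \<Longrightarrow> \<exists>\<alpha>. x = \<alpha> \<cdot> e" "md h 0 x = 0 \<Longrightarrow> \<exists>\<beta>. x = \<beta> \<cdot> h"
proof -
  obtain \<alpha> \<beta> \<gamma> where x: "x = \<alpha> \<cdot> e + \<beta> \<cdot> h + \<gamma> \<cdot> f" using assms g_iff by blast
  have hx: "md h 0 x = (2 * \<alpha>) \<cdot> e + (- (2 * \<gamma>)) \<cdot> f" by (simp add: x mode_lin brackets mult.commute)
  show "\<exists>\<alpha>. x = \<alpha> \<cdot> e" if "md h 0 x = 2 \<cdot> x"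
  proof -
    have "0 \<cdot> e + (2 * \<beta>) \<cdot> h + (4 * \<gamma>) \<cdot> f = 2 \<cdot> x - md h 0 x"
      unfolding hx by (simp add: x scale_right_distrib algebra_simps scale_left_distrib[symmetric])
    thus ?thesis using ehf_independent[of 0 "2 * \<beta>" "4 * \<gamma>"] that x by auto
  qed
  show "\<exists>\<beta>. x = \<beta> \<cdot> h" if "md h 0 x = 0"
    using ehf_independent[of "2 * \<alpha>" 0 "- (2 * \<gamma>)"] that hx x by auto
qed

text \<open>Zero modes kill the vacuum, so the first product is an invariant scalar form on the
  currents. Invariance determines it from its value on \<open>h\<close>, half of which is
  \<open>k\<close>.\<close>

lemma first_products:
  obtains k where "md h 1 h = (2 * k) \<cdot> vac U" "md e 1 f = k \<cdot> vac U" "md f 1 e = k \<cdot> vac U"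
    "md h 1 e = 0" "md e 1 h = 0" "md h 1 f = 0" "md f 1 h = 0" "md e 1 e = 0" "md f 1 f = 0"
proof -
  have inv: "md (md z 0 x) 1 y + md x 1 (md z 0 y) = 0" if "x \<in> wt U 2" "y \<in> wt U 2" "z \<in> wt U 2" for x y z
  proof -
    have "md x 1 y \<in> wt U 0" by (rule mode_wt[OF that(1,2)]) simp
    then obtain a where "md x 1 y = a \<cdot> vac U" by (rule wt_0E)
    hence "md z 0 (md x 1 y) = 0" by (simp add: mode_lin creation_nonneg)
    thus ?thesis using zero_mode_derivation[OF that(3) _ that(1), of 1 y] by simp
  qed
  have "md h 1 h \<in> wt U 0" by (rule mode_wt[OF ehf_wt(2,2)]) simp
  then obtain a where "md h 1 h = a \<cdot> vac U" by (rule wt_0E)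
  hence hh: "md h 1 h = (2 * (a / 2)) \<cdot> vac U" by simp
  have he: "md h 1 e = 0" "md e 1 h = 0" "md h 1 f = 0" "md f 1 h = 0"
    using inv[OF ehf_wt(2,1,2)] inv[OF ehf_wt(1,2,2)] inv[OF ehf_wt(2,3,2)] inv[OF ehf_wt(3,2,2)]
    by (simp_all add: brackets mode_lin)
  have ee: "md e 1 e = 0" "md f 1 f = 0"
    using inv[OF ehf_wt(1,1,2)] inv[OF ehf_wt(3,3,2)]
    by (simp_all add: brackets mode_lin double_eq_0 neg_eq_self)
  have "2 \<cdot> md e 1 f = 2 \<cdot> ((a / 2) \<cdot> vac U)" "2 \<cdot> md f 1 e = 2 \<cdot> ((a / 2) \<cdot> vac U)"
    using inv[OF ehf_wt(2,3,1)] inv[OF ehf_wt(2,1,3)] hh by (simp_all add: brackets mode_lin)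
  hence "md e 1 f = (a / 2) \<cdot> vac U" "md f 1 e = (a / 2) \<cdot> vac U"
    by (metis scale_left_imp_eq zero_neq_numeral)+
  thus ?thesis using that hh he ee by blast
qed

text \<open>The usual highest weight argument. In dimension two \<open>h(0)\<close> cannot have
  three distinct eigenvalues, which bounds both raising and lowering, and
  \<open>e(0)f(0)^2 a = (2\<mu> - 2) f(0)a\<close> then forces the highest weight
  \<open>\<mu>\<close> to be 1.\<close>

lemma vector_representation_basis:
  assumes rep: "vector_representation U g W"
  obtains a where "a \<in> W" "a \<noteq> 0" "md f 0 a \<in> W" "md f 0 a \<noteq> 0"
    "md h 0 a = a" "md e 0 a = 0" "md h 0 (md f 0 a) = - md f 0 a" "md e 0 (md f 0 a) = a" "md f 0 (md f 0 a) = 0"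
    "\<And>w. w \<in> W \<Longrightarrow> \<exists>\<alpha> \<beta>. w = \<alpha> \<cdot> a + \<beta> \<cdot> md f 0 a"
    "\<And>\<alpha> \<beta>. \<alpha> \<cdot> a + \<beta> \<cdot> md f 0 a = 0 \<Longrightarrow> \<alpha> = 0 \<and> \<beta> = 0"
proof -
  have W: "subspace W" "dim W = 2" and inv: "\<And>x w. x \<in> g \<Longrightarrow> w \<in> W \<Longrightarrow> md x 0 w \<in> W" and "W \<noteq> {0}"
    and irr: "\<And>W'. W' \<subseteq> W \<Longrightarrow> invariant_subspace U g W' \<Longrightarrow> W' = {0} \<or> W' = W"
    using rep by (auto simp: vector_representation_def irreducible_module_def invariant_subspace_def)
  have three: False if t: "x \<in> W" "y \<in> W" "z \<in> W" "x \<noteq> 0" "y \<noteq> 0" "z \<noteq> 0"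
    "md h 0 x = a \<cdot> x" "md h 0 y = b \<cdot> y" "md h 0 z = c \<cdot> z" "a \<noteq> b" "b \<noteq> c" "a \<noteq> c" for x y z a b c
  proof -
    obtain \<alpha> \<beta> where z: "z = \<alpha> \<cdot> x + \<beta> \<cdot> y"
      using dim_2_span[OF W t(1,2,3) eigenvectors_independent[OF t(7,8,10,4,5)]] by blast
    have "c \<cdot> z = md h 0 z" using t by simp
    hence "(\<alpha> * (c - a)) \<cdot> x + (\<beta> * (c - b)) \<cdot> y = 0"
      using t(7,8) by (simp add: z mode_lin algebra_simps scale_right_distrib scale_left_diff_distrib scale_right_diff_distrib)
    hence "\<alpha> * (c - a) = 0 \<and> \<beta> * (c - b) = 0" by (rule eigenvectors_independent[OF t(7,8,10,4,5)])
    thus False using z t by auto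
  qed
  have he: "md h 0 (md e 0 w) = (r + 2) \<cdot> md e 0 w" and hf: "md h 0 (md f 0 w) = (r - 2) \<cdot> md f 0 w"
    if "md h 0 w = r \<cdot> w" for w r
    using that ehf_derivation(2)[OF _ ehf_wt(1), of 0 w] ehf_derivation(2)[OF _ ehf_wt(3), of 0 w]
    by (simp_all add: brackets mode_lin scale_left_distrib scale_left_diff_distrib)
  have ef: "md e 0 (md f 0 w) = md h 0 w + md f 0 (md e 0 w)" for w
    using ehf_derivation(1)[OF _ ehf_wt(3), of 0 w] by (simp add: brackets)
  obtain w where "w \<in> W" "w \<noteq> 0" using \<open>W \<noteq> {0}\<close> subspace_0[OF W(1)] by blast
  then obtain v r where v: "v \<in> W" "v \<noteq> 0" "md h 0 v = r \<cdot> v"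
    using eigenvector_exists[OF W inv[OF ehf_g(2)]] by blast
  obtain a \<mu> where a: "a \<in> W" "a \<noteq> 0" "md h 0 a = \<mu> \<cdot> a" "md e 0 a = 0"
  proof (cases "md e 0 v = 0")
    case False
    have "md e 0 (md e 0 v) = 0"
      using three[OF v(1) inv[OF ehf_g(1) v(1)] inv[OF ehf_g(1) inv[OF ehf_g(1) v(1)]] v(2) False _ v(3) he[OF v(3)] he[OF he[OF v(3)]]]
      by auto
    thus ?thesis using that[of "md e 0 v"] False he[OF v(3)] inv[OF ehf_g(1) v(1)] by blast
  qed (use v that in blast)
  have fa: "md f 0 a \<in> W" using inv ehf_g a by blast
  have fa0: "md f 0 a \<noteq> 0"
  proof
    assume 0: "md f 0 a = 0"
    \<comment> \<open>If \<open>f(0)a\<close> vanished, the line through \<open>a\<close> would be a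
      proper invariant subspace, against irreducibility.\<close>
    have "invariant_subspace U g (span {a})"
      unfolding invariant_subspace_def
    proof (intro conjI ballI)
      fix x w assume "x \<in> g" "w \<in> span {a}"
      then obtain \<alpha> \<beta> \<gamma> c where "x = \<alpha> \<cdot> e + \<beta> \<cdot> h + \<gamma> \<cdot> f" "w = c \<cdot> a"
        using g_iff by (auto simp: span_singleton)
      thus "md x 0 w \<in> span {a}" using 0 a by (simp add: mode_lin span_base span_scale)
    qed simp
    moreover have "span {a} \<subseteq> W" using a(1) W(1) by (intro span_minimal) auto
    moreover have "span {a} \<noteq> {0}" using a(2) span_base[of a "{a}"] by auto
    ultimately have "W = span {a}" using irr by blast
    hence "dim W \<le> 1" using dim_le_card[of W "{a}"] by simp
    thus False using W(2) by simp
  qed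
  have ffa: "md f 0 (md f 0 a) = 0"
    using three[OF a(1) fa inv[OF ehf_g(3) fa] a(2) fa0 _ a(3) hf[OF a(3)] hf[OF hf[OF a(3)]]] by auto
  have "md e 0 (md f 0 (md f 0 a)) = (2 * \<mu> - 2) \<cdot> md f 0 a"
    unfolding ef[of "md f 0 a"] ef[of a] hf[OF a(3)] a(3,4) mode_lin
    by (simp add: scale_left_distrib[symmetric])
  hence \<mu>: "\<mu> = 1" using ffa fa0 by (simp add: mode_lin)
  have ind: "\<alpha> = 0 \<and> \<beta> = 0" if "\<alpha> \<cdot> a + \<beta> \<cdot> md f 0 a = 0" for \<alpha> \<beta>
    by (rule eigenvectors_independent[OF a(3) hf[OF a(3)] _ a(2) fa0 that]) simp
  show ?thesis
  proof (rule that[OF a(1,2) fa fa0 _ a(4) _ _ ffa _ ind])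
    show "md h 0 a = a" "md h 0 (md f 0 a) = - md f 0 a" "md e 0 (md f 0 a) = a"
      using a hf[OF a(3)] \<mu> by (simp_all add: ef mode_lin)
    show "\<exists>\<alpha> \<beta>. w = \<alpha> \<cdot> a + \<beta> \<cdot> md f 0 a" if "w \<in> W" for w
      by (rule dim_2_span[OF W a(1) fa that ind])
  qed
qed

text \<open>The tensor square of the vector representation is the adjoint plus the trivial module.
  The trivial part \<open>X(1)Y' - X'(1)Y\<close> maps to 0 because \<open>sl2\<close> has no
  nonzero invariants, and lowering the image of the highest weight vector gives the rest.\<close>

lemma tensor_products_in_g:
  assumes X: "X \<in> wt U 3" and X': "X' \<in> wt U 3"
    and a: "md h 0 X = X" "md e 0 X = 0" "md h 0 X' = - X'" "md e 0 X' = X" "md f 0 X = X'" "md f 0 X' = 0"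
    and b: "md h 0 Y = Y" "md e 0 Y = 0" "md h 0 Y' = - Y'" "md e 0 Y' = Y" "md f 0 Y = Y'" "md f 0 Y' = 0"
    and g: "md X 1 Y \<in> g" "md X 1 Y' - md X' 1 Y \<in> g"
  shows "\<exists>\<mu>. md X 1 Y = (2 * \<mu>) \<cdot> e \<and> md X 1 Y' = (- \<mu>) \<cdot> h \<and> md X' 1 Y = (- \<mu>) \<cdot> h \<and> md X' 1 Y' = (- 2 * \<mu>) \<cdot> f"
proof -
  note der = ehf_derivation[OF _ X, of 1] ehf_derivation[OF _ X', of 1]
  have "md h 0 (md X 1 Y) = 2 \<cdot> md X 1 Y" by (simp add: der a b double_scale)
  then obtain \<nu> where \<nu>: "md X 1 Y = \<nu> \<cdot> e" using weight_vectors_in_g(1)[OF g(1)] by blast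
  define s where "s = md X 1 Y' - md X' 1 Y"
  have "md h 0 s = 0" "md e 0 s = 0" by (simp_all add: s_def der a b mode_lin)
  moreover obtain \<beta> where "s = \<beta> \<cdot> h" using weight_vectors_in_g(2)[OF g(2)] \<open>md h 0 s = 0\<close> unfolding s_def by blast
  ultimately have "s = 0" using ehf_nonzero by (auto simp: mode_lin brackets)
  hence XY: "md X' 1 Y = md X 1 Y'" by (simp add: s_def)
  have "md f 0 (md X 1 Y) = md X 1 Y' + md X 1 Y'" by (simp add: der a b XY mode_lin)
  hence "2 \<cdot> md X 1 Y' = 2 \<cdot> ((- (\<nu> / 2)) \<cdot> h)" by (simp add: \<nu> mode_lin brackets double_scale)
  hence XY': "md X 1 Y' = (- (\<nu> / 2)) \<cdot> h" by (metis scale_left_imp_eq zero_neq_numeral)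
  have "md X' 1 Y' = md f 0 (md X 1 Y')" by (simp add: der a b mode_lin)
  also have "\<dots> = (- \<nu>) \<cdot> f" by (simp add: XY' mode_lin brackets)
  finally show ?thesis using \<nu> XY XY' by (intro exI[of _ "\<nu> / 2"]) simp
qed

text \<open>The vector in the intersection is split into weight components, and each nonzero component
  is raised to the highest weight, where both spaces have dimension one.\<close>
lemma translation_highest_weight:
  assumes X: "X \<in> wt U 3" and X': "X' \<in> wt U 3"
    and a: "md h 0 X = X" "md e 0 X = 0" "md h 0 X' = - X'" "md e 0 X' = X" "md f 0 X = X'" "md f 0 X' = 0"
    and b: "md h 0 Y = Y" "md e 0 Y = 0" "md h 0 Y' = - Y'" "md e 0 Y' = Y" "md f 0 Y = Y'" "md f 0 Y' = 0"
    and u: "u \<in> g" "u \<noteq> 0"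
    and Tu: "translation U u = p \<cdot> md X 0 Y + q \<cdot> md X 0 Y' + r \<cdot> md X' 0 Y + t \<cdot> md X' 0 Y'"
  shows "\<exists>\<rho>. translation U e = \<rho> \<cdot> md X 0 Y"
proof -
  note der = ehf_derivation[OF _ X, of 0] ehf_derivation[OF _ X', of 0]
  note T = zero_mode_translation[OF ehf_wt(1)] zero_mode_translation[OF ehf_wt(2)]
  obtain \<alpha> \<beta> \<gamma> where uu: "u = \<alpha> \<cdot> e + \<beta> \<cdot> h + \<gamma> \<cdot> f" using u g_iff by blast
  define R where "R = p \<cdot> md X 0 Y + q \<cdot> md X 0 Y' + r \<cdot> md X' 0 Y + t \<cdot> md X' 0 Y'"
  have eig: "md h 0 (md X 0 Y) = 2 \<cdot> md X 0 Y" "md h 0 (md X' 0 Y') = - (2 \<cdot> md X' 0 Y')"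
    "md h 0 (md X 0 Y') = 0" "md h 0 (md X' 0 Y) = 0"
    by (simp_all add: mode_lin der a b double_scale)
  have hT: "md h 0 (translation U u) = (2 * \<alpha>) \<cdot> translation U e - (2 * \<gamma>) \<cdot> translation U f"
    by (simp add: T uu mode_lin brackets translation_linear mult.commute)
  have hR: "md h 0 R = (2 * p) \<cdot> md X 0 Y - (2 * t) \<cdot> md X' 0 Y'"
    by (simp add: R_def mode_lin eig mult.commute)
  have hhT: "md h 0 (md h 0 (translation U u)) = (4 * \<alpha>) \<cdot> translation U e + (4 * \<gamma>) \<cdot> translation U f"
    unfolding hT by (simp add: mode_lin T brackets translation_linear)
  have hhR: "md h 0 (md h 0 R) = (4 * p) \<cdot> md X 0 Y + (4 * t) \<cdot> md X' 0 Y'"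
    unfolding hR by (simp add: mode_lin eig)
  have TR: "translation U u = R" using Tu by (simp add: R_def)
  \<comment> \<open>Applying \<open>h(0)\<close> once and twice to the relation yields two equations
    from which the components of weight 2, 0 and -2 are separated.\<close>
  have i1: "(2 * \<alpha>) \<cdot> translation U e - (2 * \<gamma>) \<cdot> translation U f = (2 * p) \<cdot> md X 0 Y - (2 * t) \<cdot> md X' 0 Y'"
    using hT hR TR by simp
  have i2: "(4 * \<alpha>) \<cdot> translation U e + (4 * \<gamma>) \<cdot> translation U f = (4 * p) \<cdot> md X 0 Y + (4 * t) \<cdot> md X' 0 Y'"
    using hhT hhR TR by simp
  have four: "x = y" if "4 \<cdot> x = 4 \<cdot> y" for x y :: 'v using that by simp
  have i3: "2 \<cdot> ((2 * \<alpha>) \<cdot> translation U e) - 2 \<cdot> ((2 * \<gamma>) \<cdot> translation U f) = 2 \<cdot> ((2 * p) \<cdot> md X 0 Y) - 2 \<cdot> ((2 * t) \<cdot> md X' 0 Y')"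
    using arg_cong[OF i1, of "scl 2"] by (simp only: scale_right_diff_distrib)
  have "8 \<cdot> (\<alpha> \<cdot> translation U e) = 8 \<cdot> (p \<cdot> md X 0 Y)"
    using arg_cong2[OF i2 i3, of "(+)"] by (simp add: scale_left_distrib[symmetric])
  hence c2: "\<alpha> \<cdot> translation U e = p \<cdot> md X 0 Y" by (metis scale_left_imp_eq zero_neq_numeral)
  have "4 \<cdot> (\<gamma> \<cdot> translation U f) = 4 \<cdot> (t \<cdot> md X' 0 Y')"
    using i2 arg_cong[OF c2, of "scl 4"] by simp
  hence c0: "\<gamma> \<cdot> translation U f = t \<cdot> md X' 0 Y'" by (rule four)
  have c1: "\<beta> \<cdot> translation U h = q \<cdot> md X 0 Y' + r \<cdot> md X' 0 Y"
    using TR c2 c0 by (simp add: uu translation_linear R_def)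
  \<comment> \<open>The component of weight 0 is raised once and that of weight -2 twice.\<close>
  have d1: "(- 2 * \<beta>) \<cdot> translation U e = (q + r) \<cdot> md X 0 Y"
    using arg_cong[OF c1, of "md e 0"] by (simp add: mode_lin T brackets translation_linear der a b scale_left_distrib mult.commute)
  have d0: "(- 2 * \<gamma>) \<cdot> translation U e = (2 * t) \<cdot> md X 0 Y"
    using arg_cong[OF c0, of "\<lambda>x. md e 0 (md e 0 x)"]
    by (simp add: mode_lin T brackets translation_linear der a b mult.commute double_scale[symmetric])
  have solve: "\<exists>\<rho>. translation U e = \<rho> \<cdot> md X 0 Y" if "c \<cdot> translation U e = d \<cdot> md X 0 Y" "c \<noteq> 0" for c d
  proof -
    have "c \<cdot> translation U e = c \<cdot> ((d / c) \<cdot> md X 0 Y)" using that by simp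
    thus ?thesis using scale_left_imp_eq that(2) by blast
  qed
  have "\<alpha> \<noteq> 0 \<or> - 2 * \<beta> \<noteq> 0 \<or> - 2 * \<gamma> \<noteq> 0" using u uu by auto
  thus ?thesis using solve c2 d1 d0 by blast
qed

section \<open>Normalized weight bases and assembly of the relations\<close>

lemma n4_algebra_of_doublets:
  fixes S A B :: "'v set"
  assumes k: "md h 1 h = (2 * k) \<cdot> vac U" "md e 1 f = k \<cdot> vac U" "md f 1 e = k \<cdot> vac U"
    "md h 1 e = 0" "md h 1 f = 0" "md e 1 e = 0" "md f 1 f = 0"
    and S: "\<And>x. x \<in> S \<Longrightarrow> primary U (conf U) 3 x"
    and AB: "A \<inter> B = {0}" "span S = {a + b | a b. a \<in> A \<and> b \<in> B}"
    and repA: "vector_representation U g A" and repB: "vector_representation U g B"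
    and g: "g = mode_span U A 1 B"
    and AA: "mode_span U A 0 A = {0}" and BB: "mode_span U B 0 B = {0}"
    and T: "translation U ` g \<inter> mode_span U A 0 B \<noteq> {0}"
  shows "N4_algebra U (generated U S) (6 * k)"
proof -
  have sub: "subspace A" "subspace B"
    using repA repB by (auto simp: vector_representation_def irreducible_module_def invariant_subspace_def)
  have ABS: "x \<in> A \<Longrightarrow> x \<in> span S" "x \<in> B \<Longrightarrow> x \<in> span S" for x
    using AB(2) subspace_0[OF sub(1)] subspace_0[OF sub(2)] by force+
  have prim: "primary U (conf U) 3 x" if "x \<in> span S" for x
  proof -
    have "span S \<subseteq> {x. primary U (conf U) 3 x}"
      by (rule span_minimal) (use S in \<open>auto simp: subspace_def primary_def vir_def wt_lin mode_lin\<close>)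
    thus ?thesis using that by blast
  qed
  have primn: "md (conf U) n x = 0" if "x \<in> span S" "n \<ge> 2" for x n
    using prim[OF that(1)] that(2) unfolding primary_def vir_def by (auto dest: spec[of _ "n - 1"])
  have wt3: "x \<in> wt U 3" if "x \<in> span S" for x using prim[OF that] by (simp add: primary_def)
  obtain a where a: "a \<in> A" "a \<noteq> 0" "md f 0 a \<in> A" "md f 0 a \<noteq> 0"
    "md h 0 a = a" "md e 0 a = 0" "md h 0 (md f 0 a) = - md f 0 a" "md e 0 (md f 0 a) = a" "md f 0 (md f 0 a) = 0"
    "\<And>w. w \<in> A \<Longrightarrow> \<exists>\<alpha> \<beta>. w = \<alpha> \<cdot> a + \<beta> \<cdot> md f 0 a"
    "\<And>\<alpha> \<beta>. \<alpha> \<cdot> a + \<beta> \<cdot> md f 0 a = 0 \<Longrightarrow> \<alpha> = 0 \<and> \<beta> = 0"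
    using vector_representation_basis[OF repA] by metis
  obtain b where b: "b \<in> B" "b \<noteq> 0" "md f 0 b \<in> B" "md f 0 b \<noteq> 0"
    "md h 0 b = b" "md e 0 b = 0" "md h 0 (md f 0 b) = - md f 0 b" "md e 0 (md f 0 b) = b" "md f 0 (md f 0 b) = 0"
    "\<And>w. w \<in> B \<Longrightarrow> \<exists>\<alpha> \<beta>. w = \<alpha> \<cdot> b + \<beta> \<cdot> md f 0 b"
    "\<And>\<alpha> \<beta>. \<alpha> \<cdot> b + \<beta> \<cdot> md f 0 b = 0 \<Longrightarrow> \<alpha> = 0 \<and> \<beta> = 0"
    using vector_representation_basis[OF repB] by metis
  define a' b' where "a' = md f 0 a" and "b' = md f 0 b"
  note a = a[folded a'_def] and b = b[folded b'_def]
  note fa = a'_def[symmetric] and fb = b'_def[symmetric]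
  have aw: "a \<in> wt U 3" "a' \<in> wt U 3" "b \<in> wt U 3" "b' \<in> wt U 3" using a b ABS wt3 by blast+
  have mg: "x \<in> A \<Longrightarrow> y \<in> B \<Longrightarrow> md x 1 y \<in> g" for x y unfolding g by (rule mode_span_mem)
  have "subspace g" unfolding g mode_span_def by simp
  hence "\<exists>\<mu>. md a 1 b = (2 * \<mu>) \<cdot> e \<and> md a 1 b' = (- \<mu>) \<cdot> h \<and> md a' 1 b = (- \<mu>) \<cdot> h \<and> md a' 1 b' = (- 2 * \<mu>) \<cdot> f"
    by (intro tensor_products_in_g[OF aw(1,2) a(5-8) fa a(9) b(5-8) fb b(9)] subspace_diff mg a b)
  then obtain \<mu> where \<mu>: "md a 1 b = (2 * \<mu>) \<cdot> e" "md a 1 b' = (- \<mu>) \<cdot> h" "md a' 1 b = (- \<mu>) \<cdot> h"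
    "md a' 1 b' = (- 2 * \<mu>) \<cdot> f" by blast
  have tensor: "\<exists>p q r t. z = p \<cdot> md a n b + q \<cdot> md a n b' + r \<cdot> md a' n b + t \<cdot> md a' n b'"
    if "z \<in> mode_span U A n B" for z n
  proof -
    let ?T = "{md a n b, md a n b', md a' n b, md a' n b'}"
    have "mode_span U A n B \<subseteq> span ?T"
      unfolding mode_span_def
    proof (rule span_minimal, safe)
      fix u v assume "u \<in> A" "v \<in> B"
      then obtain \<alpha> \<beta> \<gamma> \<delta> where "u = \<alpha> \<cdot> a + \<beta> \<cdot> a'" "v = \<gamma> \<cdot> b + \<delta> \<cdot> b'" using a(10) b(10) by meson
      thus "md u n v \<in> span ?T" by (auto simp: mode_lin intro!: span_add span_scale intro: span_base)
    qed
    hence "z \<in> span ?T" using that by blast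
    then obtain p q r t where "z - p \<cdot> md a n b - q \<cdot> md a n b' - r \<cdot> md a' n b = t \<cdot> md a' n b'"
      by (auto simp: span_breakdown_eq)
    hence "z = p \<cdot> md a n b + q \<cdot> md a n b' + r \<cdot> md a' n b + t \<cdot> md a' n b'"
      by (simp add: diff_eq_eq add_ac)
    thus ?thesis by blast
  qed
  \<comment> \<open>All four products spanning \<open>g\<close> are multiples of
    \<open>\<mu>\<close>, while \<open>g\<close> contains \<open>h\<close>.\<close>
  have \<mu>0: "\<mu> \<noteq> 0"
  proof
    assume "\<mu> = 0"
    hence "h = 0" using tensor[of h 1] ehf_g(2) g by (auto simp: \<mu>)
    thus False using ehf_nonzero by simp
  qed
  \<comment> \<open>The zero vector always lies in the intersection, so the hypothesis yields a
    nonzero element.\<close>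
  obtain u where u: "u \<in> g" "translation U u \<noteq> 0" "translation U u \<in> mode_span U A 0 B"
  proof -
    have "0 \<in> translation U ` g \<inter> mode_span U A 0 B"
      using \<open>subspace g\<close> by (auto simp: mode_span_def span_zero translation_linear subspace_0 intro!: image_eqI[of _ _ 0])
    thus ?thesis using T that by blast
  qed
  have "u \<noteq> 0" using u(2) by (auto simp: translation_linear)
  then obtain \<rho> where \<rho>: "translation U e = \<rho> \<cdot> md a 0 b"
    using tensor[OF u(3)] translation_highest_weight[OF aw(1,2) a(5-8) fa a(9) b(5-8) fb b(9) u(1)] by blast
  have A0: "md x 0 y = 0" if "x \<in> A" "y \<in> A" for x y using mode_span_mem[OF that, of 0] AA by blast
  have B0: "md x 0 y = 0" if "x \<in> B" "y \<in> B" for x y using mode_span_mem[OF that, of 0] BB by blast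
  define G where "G s = (if s = 1 then a else a')" for s :: int
  \<comment> \<open>The factor \<open>1 / \<mu>\<close> turns \<open>a(1)b = 2\<mu> e\<close> into
    \<open>2 J 1\<close>. The sign at the lower index gives
    \<open>J (-1) (0) Gb 1 = - Gb (-1)\<close>.\<close>
  define Gb where "Gb s = (if s = 1 then (1 / \<mu>) \<cdot> b else (- 1 / \<mu>) \<cdot> b')" for s :: int
  define J where "J s = (if s = 1 then e else f)" for s :: int
  note defs = G_def Gb_def J_def
  have pm: "s = 1 \<or> s = -1" if "\<bar>s\<bar> = 1" for s :: int using that by linarith
  \<comment> \<open>Since \<open>b = \<mu> Gb 1\<close>, the relation
    \<open>Te = \<rho> a(0)b\<close> holds for the rescaled vectors with factor
    \<open>\<rho> * \<mu>\<close>.\<close>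
  interpret n4_doublets U G Gb J h k "\<rho> * \<mu>"
  proof
    fix s t n :: int assume s: "\<bar>s\<bar> = 1" note s' = pm[OF s]
    show "G s \<in> wt U 3" "Gb s \<in> wt U 3" "J s \<in> wt U 2"
      using s' aw ehf_wt by (auto simp: defs wt_lin)
    show "md (conf U) n (G s) = 0" "md (conf U) n (Gb s) = 0" if "n \<ge> 2"
      using s' that primn[OF ABS(1) that] primn[OF ABS(2) that] a b by (auto simp: defs mode_lin)
    show "md (G s) 0 (G t) = 0" "md (Gb s) 0 (Gb t) = 0" if "\<bar>t\<bar> = 1"
      using A0 B0 a b by (auto simp: defs mode_lin)
    show "md h 0 (G s) = of_int s \<cdot> G s" "md h 0 (Gb s) = of_int s \<cdot> Gb s"
      using s' a b by (auto simp: defs mode_lin)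
    show "md (J s) 0 (G s) = 0" "md (J s) 0 (G (- s)) = G s"
      using s' a b fa by (auto simp: defs mode_lin)
    show "md (J s) 0 (Gb s) = 0" "md (J s) 0 (Gb (- s)) = - Gb s"
      using s' a b fb by (auto simp: defs mode_lin)
    show "md (G s) 1 (Gb s) = 2 \<cdot> J s" "md (G s) 1 (Gb (- s)) = of_int s \<cdot> h"
      using s' \<mu>0 by (auto simp: defs mode_lin \<mu>)
    show "md h 0 (J s) = (2 * of_int s) \<cdot> J s" "md (J s) 0 (J s) = 0" "md (J s) 0 (J (- s)) = of_int s \<cdot> h"
      "md (J s) 0 h = (- 2 * of_int s) \<cdot> J s"
      using s' by (auto simp: defs brackets)
    show "md h 1 (J s) = 0" "md (J s) 1 (J s) = 0" "md (J s) 1 (J (- s)) = k \<cdot> vac U"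
      using s' by (auto simp: defs k)
  next
    show "h \<in> wt U 2" "md h 0 h = 0" "md h 1 h = (2 * k) \<cdot> vac U" "J 1 \<noteq> 0"
      by (simp_all add: ehf_wt brackets k J_def ehf_nonzero)
    show "translation U (J 1) = (\<rho> * \<mu>) \<cdot> md (G 1) 0 (Gb 1)"
      using \<rho> \<mu>0 by (simp add: defs mode_lin)
  qed
  have AB0: "x \<noteq> y" if "x \<in> A" "y \<in> B" "x \<noteq> 0" for x y using that AB(1) by auto
  have "a \<noteq> a'" using a(11)[of 1 "- 1"] by auto
  moreover have "Gb 1 \<noteq> Gb (- 1)" using b(11)[of "1 / \<mu>" "1 / \<mu>"] \<mu>0 by (auto simp: Gb_def eq_neg_iff_add_eq_0)
  moreover have "Gb s \<in> B" for s using b sub(2) by (simp add: Gb_def subspace_scale subspace_neg)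
  ultimately have "distinct [G 1, G (- 1), Gb 1, Gb (- 1)]"
    using AB0[OF a(1) _ a(2)] AB0[OF a(3) _ a(4)] by (auto simp: G_def)
  hence "N4_algebra U (generated U gens) (6 * k)" by (rule n4_algebra)
  moreover have "generated U gens = generated U S"
  proof
    have "gens \<subseteq> span S" using ABS a b \<open>Gb _ \<in> B\<close> by (auto simp: G_def)
    thus "generated U gens \<subseteq> generated U S" by (rule generated_mono_span)
    have "S \<subseteq> span gens"
    proof
      fix x assume "x \<in> S"
      then obtain y z where yz: "x = y + z" "y \<in> A" "z \<in> B" using AB(2) span_base by blast
      obtain \<alpha> \<beta> where "y = \<alpha> \<cdot> a + \<beta> \<cdot> a'" using a(10) yz by blast
      hence y: "y = \<alpha> \<cdot> G 1 + \<beta> \<cdot> G (- 1)" by (simp add: G_def)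
      obtain \<gamma> \<delta> where "z = \<gamma> \<cdot> b + \<delta> \<cdot> b'" using b(10) yz by blast
      hence z: "z = (\<gamma> * \<mu>) \<cdot> Gb 1 + (- \<delta> * \<mu>) \<cdot> Gb (- 1)" using \<mu>0 by (simp add: Gb_def)
      show "x \<in> span gens" unfolding yz(1) y z by (intro span_add span_scale) (auto intro: span_base)
    qed
    thus "generated U S \<subseteq> generated U gens" by (rule generated_mono_span)
  qed
  ultimately show ?thesis by simp
qed

end

section \<open>Currents as matrices, the invariant form and the level\<close>

theorem theorem1:
  fixes U :: "'v::ab_group_add svoa_data"
    and S V A B :: "'v set"
    and \<phi> :: "complex^2^2 \<Rightarrow> 'v"
  assumes "svoa U" and "cft_type U"
    and "card S = 4" and "\<forall>x\<in>S. primary U (conf U) 3 x"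
    and "V = generated U S"
    and "A \<inter> B = {0}" and "cspan U S = {a + b | a b. a \<in> A \<and> b \<in> B}"
    and "vector_representation U (mode_span U A 1 B) A"
    and "vector_representation U (mode_span U A 1 B) B"
    and "sl2_iso U (mode_span U A 1 B) \<phi>"
    and "mode_span U A 0 A = {0}" and "mode_span U B 0 B = {0}"
    and "translation U ` mode_span U A 1 B \<inter> mode_span U A 0 B \<noteq> {0}"
  shows "\<exists>k. level U (mode_span U A 1 B) \<phi> k \<and> N4_algebra U V (6 * k)"
proof -
  interpret cft_svoa U using assms(1,2) by (simp add: cft_svoa_def cft_svoa_axioms_def)
  define g where "g = mode_span U A 1 B"
  have sub: "subspace A" "subspace B"
    using assms(8,9) by (auto simp: vector_representation_def irreducible_module_def invariant_subspace_def)
  have AB_wt: "x \<in> wt U 3" if "x \<in> A \<or> x \<in> B" for x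
  proof -
    have "x \<in> span S" using assms(7) that subspace_0[OF sub(1)] subspace_0[OF sub(2)] by force
    moreover have "span S \<subseteq> wt U 3"
      by (rule span_minimal) (use assms(4) in \<open>auto simp: primary_def wt_subspace\<close>)
    ultimately show ?thesis by blast
  qed
  have g_wt: "x \<in> wt U 2" if "x \<in> g" for x
  proof -
    have "md a 1 b \<in> wt U 2" if "a \<in> A" "b \<in> B" for a b
      using that by (intro mode_wt[OF AB_wt AB_wt]) auto
    hence "g \<subseteq> wt U 2" unfolding g_def mode_span_def by (intro span_minimal wt_subspace) auto
    thus ?thesis using that by blast
  qed
  have iso: "bij_betw \<phi> sl2 g"
    and add: "\<And>M N. M \<in> sl2 \<Longrightarrow> N \<in> sl2 \<Longrightarrow> \<phi> (M + N) = \<phi> M + \<phi> N"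
    and scale: "\<And>a M. M \<in> sl2 \<Longrightarrow> \<phi> (mat a ** M) = a \<cdot> \<phi> M"
    and br: "\<And>M N. M \<in> sl2 \<Longrightarrow> N \<in> sl2 \<Longrightarrow> md (\<phi> M) 0 (\<phi> N) = \<phi> (M ** N - N ** M)"
    using assms(10) unfolding sl2_iso_def g_def by auto
  define e h f where "e = \<phi> sl2_e" and "h = \<phi> sl2_cartan" and "f = \<phi> sl2_f"
  have \<phi>: "\<phi> M = M$1$2 \<cdot> e + M$1$1 \<cdot> h + M$2$1 \<cdot> f" if "M \<in> sl2" for M
  proof -
    have "\<phi> M = \<phi> (mat (M$1$2) ** sl2_e + (mat (M$1$1) ** sl2_cartan + mat (M$2$1) ** sl2_f))"
      using sl2_decompose[OF that] by simp
    thus ?thesis by (simp add: add scale sl2_mem e_def h_def f_def add.assoc)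
  qed
  have mat: "\<exists>M\<in>sl2. M$1$2 = \<alpha> \<and> M$1$1 = \<beta> \<and> M$2$1 = \<gamma>" for \<alpha> \<beta> \<gamma> :: complex
    by (rule bexI[of _ "vector [vector [\<beta>, \<alpha>], vector [\<gamma>, - \<beta>]]"]) (simp_all add: matrix_2_simps)
  have \<phi>0: "\<phi> 0 = 0" using \<phi>[of 0] by (simp add: sl2_def trace_def)
  have inj: "inj_on \<phi> sl2" and img: "\<phi> ` sl2 = g" using iso by (auto simp: bij_betw_def)
  interpret sl2_currents U e h f g
  proof
    show "e \<in> wt U 2" "h \<in> wt U 2" "f \<in> wt U 2"
      using img sl2_mem(1-3) by (auto simp: e_def h_def f_def intro!: g_wt)
    show "md e 0 e = 0" "md e 0 h = (- 2) \<cdot> e" "md e 0 f = h"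
      "md h 0 e = 2 \<cdot> e" "md h 0 h = 0" "md h 0 f = (- 2) \<cdot> f"
      "md f 0 e = - h" "md f 0 h = 2 \<cdot> f" "md f 0 f = 0"
      using scale[OF sl2_mem(3), of "-1"] scale[OF sl2_mem(3), of 1]
      by (simp_all only: e_def h_def f_def br sl2_mem sl2_brackets scale) (simp_all add: \<phi>0)
    show "\<alpha> = 0 \<and> \<beta> = 0 \<and> \<gamma> = 0" if "\<alpha> \<cdot> e + \<beta> \<cdot> h + \<gamma> \<cdot> f = 0" for \<alpha> \<beta> \<gamma>
    proof -
      obtain M where M: "M \<in> sl2" "M$1$2 = \<alpha>" "M$1$1 = \<beta>" "M$2$1 = \<gamma>" using mat by blast
      hence "\<phi> M = \<phi> 0" using that \<phi>[OF M(1)] \<phi>0 by simp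
      hence "M = 0" using inj M(1) by (auto simp: sl2_def trace_def dest: inj_onD)
      thus ?thesis using M by auto
    qed
    show "x \<in> g \<longleftrightarrow> (\<exists>\<alpha> \<beta> \<gamma>. x = \<alpha> \<cdot> e + \<beta> \<cdot> h + \<gamma> \<cdot> f)" for x
      unfolding img[symmetric] using \<phi> mat by (metis (no_types, lifting) image_iff)
  qed
  obtain k where k: "md h 1 h = (2 * k) \<cdot> vac U" "md e 1 f = k \<cdot> vac U" "md f 1 e = k \<cdot> vac U"
    "md h 1 e = 0" "md e 1 h = 0" "md h 1 f = 0" "md f 1 h = 0" "md e 1 e = 0" "md f 1 f = 0"
    by (rule first_products)
  define \<psi> where "\<psi> = inv_into sl2 \<phi>"
  have \<psi>: "\<psi> x \<in> sl2" "\<phi> (\<psi> x) = x" if "x \<in> g" for x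
    using that img by (auto simp: \<psi>_def inv_into_into f_inv_into_f)
  have \<psi>\<phi>: "\<psi> (\<phi> M) = M" if "M \<in> sl2" for M using that inj by (simp add: \<psi>_def)
  \<comment> \<open>The trace form of the matrix algebra, transported to \<open>g\<close> along
    \<open>\<phi>\<close>.\<close>
  define \<beta> where "\<beta> x y = trace (\<psi> x ** \<psi> y)" for x y
  have "invariant_form U g \<beta>"
    unfolding invariant_form_def
  proof (intro conjI ballI allI)
    fix x y z a assume g: "x \<in> g" "y \<in> g"
    have "\<psi> (x + y) = \<psi> x + \<psi> y"
      using \<psi>\<phi>[of "\<psi> x + \<psi> y"] by (simp add: add \<psi> g sl2_mem)
    thus "\<beta> (x + y) z = \<beta> x z + \<beta> y z"
      by (simp add: \<beta>_def matrix_2_simps algebra_simps)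
    have "\<psi> (a \<cdot> x) = mat a ** \<psi> x"
      using \<psi>\<phi>[of "mat a ** \<psi> x"] by (simp add: scale \<psi> g sl2_mem)
    thus "\<beta> (a \<cdot> x) y = a * \<beta> x y"
      by (simp add: \<beta>_def matrix_2_simps algebra_simps)
    show "\<beta> x y = \<beta> y x" by (simp add: \<beta>_def matrix_2_simps algebra_simps)
    assume z: "z \<in> g"
    have "\<psi> (md p 0 q) = \<psi> p ** \<psi> q - \<psi> q ** \<psi> p" if "p \<in> g" "q \<in> g" for p q
      using \<psi>\<phi>[of "\<psi> p ** \<psi> q - \<psi> q ** \<psi> p"] br[of "\<psi> p" "\<psi> q"] that by (simp add: \<psi> sl2_mem)
    thus "\<beta> (md x 0 y) z = \<beta> x (md y 0 z)"
      using g z by (simp add: \<beta>_def trace_invariant)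
  qed
  moreover have "\<beta> (\<phi> sl2_cartan) (\<phi> sl2_cartan) = 2"
    by (simp add: \<beta>_def \<psi>\<phi> sl2_mem) (simp add: matrix_2_simps)
  moreover have "md x 1 y = (k * \<beta> x y) \<cdot> vac U" if "x \<in> g" "y \<in> g" for x y
  proof -
    have "md x 1 y = md (\<phi> (\<psi> x)) 1 (\<phi> (\<psi> y))" using \<psi> that by simp
    also have "\<dots> = (k * \<beta> x y) \<cdot> vac U"
      unfolding \<beta>_def sl2_trace[OF \<psi>(1)[OF that(1)] \<psi>(1)[OF that(2)]] \<phi>[OF \<psi>(1)[OF that(1)]] \<phi>[OF \<psi>(1)[OF that(2)]]
      by (simp add: mode_lin k scale_left_distrib distrib_left mult_ac add_ac)
    finally show ?thesis .
  qed
  ultimately have "level U g \<phi> k" unfolding level_def by blast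
  moreover have "N4_algebra U (generated U S) (6 * k)"
    by (rule n4_algebra_of_doublets[OF k(1-4) k(6) k(8,9) _ assms(6,7) assms(8,9)[folded g_def] g_def assms(11,12)
        assms(13)[folded g_def]]) (use assms(4) in blast)
  ultimately show ?thesis using assms(5) g_def by blast
qed

end
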